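(* Let $n$ be a positive integer with $\nu(n)\geq 21$, or equivalently, $n\geq 135$. Then $$q(n)=\frac{\sqrt{2}\,\pi^2}{12\,\nu(n)}I_{1}(\nu(n))+R(n),$$ where $$|R(n)|\leq \frac{\sqrt{3}\,\pi^{\frac{3}{2}}}{6\,\nu(n)^{\frac{1}{2}}}\exp\left(\frac{\nu(n)}{3}\right).$$
   Context: For an integer $n\ge 0$, $q(n)$ is the number of partitions of $n$ into distinct parts, with generating function $\sum_{n\ge 0}q(n)x^n=\prod_{j=1}^{\infty}(1+x^j)$. Define $$\nu(n)=\frac{\pi\sqrt{24n+1}}{6\sqrt{2}}.$$ $I_1(s)$ is the first modified Bessel function of the first kind, $$I_1(s)=\frac{s}{\pi}\int_{-1}^1(1-t^2)^{\frac{1}{2}}e^{st}\,\mathrm{d}t.$$ *)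

theory Defs
  imports "HOL-Analysis.Analysis"
begin

text \<open>A partition of \<open>n\<close> into distinct parts has no repeated part, so it is the same thing as a
  finite set of positive integers with sum \<open>n\<close>.\<close>

definition distinct_partitions :: "nat \<Rightarrow> nat set set" where
  "distinct_partitions n = {P. finite P \<and> (\<forall>k\<in>P. 0 < k) \<and> \<Sum>P = n}"

definition q :: "nat \<Rightarrow> nat" where
  "q n = card (distinct_partitions n)"

lemma finite_distinct_partitions: "finite (distinct_partitions n)"
proof (rule finite_subset)
  show "distinct_partitions n \<subseteq> Pow {..n}"
    by (auto simp: distinct_partitions_def intro: member_le_sum[where f = "\<lambda>x. x", simplified])
qed simp

definition \<nu> :: "nat \<Rightarrow> real" where
  "\<nu> n = pi * sqrt (24 * real n + 1) / (6 * sqrt 2)"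

text \<open>The modified Bessel function of the first kind of order 1, at real arguments.\<close>

definition bessel_I1 :: "real \<Rightarrow> real" where
  "bessel_I1 s = s / pi * integral {-1..1} (\<lambda>t. (1 - t\<^sup>2) powr (1/2) * exp (s * t))"

end

(*
  The generating function of q is, up to elementary factors, Weber's modular function f_2.  Integrate
  it over the line Re z = y with y = pi / (36 nu(n)), a third of the height of the saddle point.

  Near z = y the inversion z -> 1/z turns f_2 into f_1, which is exp (pi / (24 z)) up to a bounded error;
  closing the segment by a rectangle to the left, where the integrand is small, gives the residue of
  exp (a z + b / z) at 0, which is the Bessel term.

  On the rest of the line only the absolute value of f_2 matters, and for this the two generators of the
  modular group suffice: moving the point up to height at least 1/2 bounds |f_2| by a constant times
  exp (pi h / 24), h being the height reached, and the bottom row (c, d) of the matrix used gives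
  h <= 1 / (c^2 y).  For even c the function is bounded.  So apart from the main segment the worst case is
  c = 3, where the integrand is of size exp (nu(n) / 3), on a set of length O(y) only; elsewhere it is
  smaller by a factor exp (- 7 nu(n) / 96).
*)

theory Submission
  imports Defs "HOL-Complex_Analysis.Complex_Analysis"
begin

text \<open>The height y balances two exponentials. If y is lambda times the saddle height pi / (12
  nu), the factor exp (a z) has size exp (lambda nu / 2) on the line, and a cusp with |c| = 3
  contributes at most exp (nu / (18 lambda)). The sum of the exponents is least at lambda = 1/3,
  where each is nu / 6 and the product is exactly exp (nu / 3). The remaining factor nu^(-1/2) comes
  from the length O(1 / nu) of the arcs near the cusps with |c| = 3, and elsewhere from nu <= exp (7
  nu / 48), an inequality that is false at nu = 20 and holds from 21 on. The main segment ends at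
  |Im z| = sqrt y. Inside it, 1 / z has real part at least 1/2, so only the leading exponential of
  the inverted function matters; outside, cusps with |c| = 1 give height at most 1; and on the
  horizontal sides of the rectangle the real part of b / w is at most b.\<close>

section \<open>Products as exponentials of Lambert series\<close>

text \<open>Expanding each ln (1 + a r^n) and summing over n first gives this series: a logarithm of
  the infinite product of the 1 + a r^n that involves no choice of branch. Its summands a^m / (1 -
  r^m) are what the partial fractions below produce.\<close>

definition logprod :: "complex \<Rightarrow> complex \<Rightarrow> complex" where
  "logprod a r = (\<Sum>m. (- 1) ^ m / of_nat (Suc m) * a ^ Suc m / (1 - r ^ Suc m))"

lemma norm_one_minus_power_ge:
  fixes r :: complex
  assumes "norm r < 1"
  shows "1 - norm r \<le> norm (1 - r ^ Suc m)"
proof -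
  have "norm (r ^ Suc m) \<le> norm r"
    using assms mult_left_le[of "norm r ^ m" "norm r"] by (simp add: norm_power norm_mult power_le_one)
  then show ?thesis
    using norm_triangle_ineq2[of 1 "r ^ Suc m"] by simp
qed

lemma norm_logprod_term_le:
  fixes a r :: complex
  assumes "norm r < 1"
  shows "norm ((- 1) ^ m / of_nat (Suc m) * a ^ Suc m / (1 - r ^ Suc m)) \<le> norm a ^ Suc m / (1 - norm r)"
proof -
  have "norm ((- 1) ^ m / of_nat (Suc m) * a ^ Suc m / (1 - r ^ Suc m))
      = norm a ^ Suc m / (real (Suc m) * norm (1 - r ^ Suc m))"
    by (simp add: norm_mult norm_divide norm_power del: of_nat_Suc power_Suc)
  also have "\<dots> \<le> norm a ^ Suc m / (1 * (1 - norm r))"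
    using assms norm_one_minus_power_ge[OF assms, of m]
    by (intro divide_left_mono mult_mono mult_pos_pos) (auto simp del: power_Suc)
  finally show ?thesis by simp
qed

lemma summable_logprod:
  fixes a r :: complex
  assumes "norm a < 1" "norm r < 1"
  shows "summable (\<lambda>m. (- 1) ^ m / of_nat (Suc m) * a ^ Suc m / (1 - r ^ Suc m))"
proof (rule summable_comparison_test')
  have "summable (\<lambda>m. norm a ^ m)"
    using assms by (intro summable_geometric) auto
  then show "summable (\<lambda>m. norm a ^ Suc m / (1 - norm r))"
    by (intro summable_divide) (subst summable_Suc_iff)
qed (use norm_logprod_term_le[OF assms(2)] in auto)

lemma norm_logprod_le:
  assumes "norm a < 1" "norm r < 1"
  shows "norm (logprod a r) \<le> norm a / ((1 - norm a) * (1 - norm r))"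
proof -
  have s: "(\<lambda>m. norm a ^ Suc m / (1 - norm r)) sums (norm a * (1 / (1 - norm a)) / (1 - norm r))"
    using sums_divide[OF sums_mult[OF geometric_sums[of "norm a"], of "norm a"], of "1 - norm r"] assms
    by simp
  have "norm (logprod a r) \<le> (\<Sum>m. norm a ^ Suc m / (1 - norm r))"
    unfolding logprod_def using s norm_logprod_term_le[OF assms(2)]
    by (intro norm_suminf_le) (auto simp: sums_iff)
  also have "\<dots> = norm a / ((1 - norm a) * (1 - norm r))"
    using sums_unique[OF s, symmetric] by (simp only:) (simp add: field_simps)
  finally show ?thesis .
qed

lemma prod_eq_exp_logprod:
  assumes "norm a < 1" "norm r < 1"
  shows "(\<Prod>n<N. 1 + a * r ^ n) = exp (logprod a r - logprod (a * r ^ N) r)"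
proof -
  have lt: "norm (a * r ^ n) < 1" for n
  proof -
    have "norm (a * r ^ n) \<le> norm a"
      using assms by (simp add: norm_mult norm_power power_le_one mult_left_le)
    then show ?thesis using assms by simp
  qed
  have ne: "1 - r ^ Suc m \<noteq> 0" for m
    using norm_one_minus_power_ge[OF assms(2), of m] assms(2) by (auto simp del: power_Suc)
  \<comment> \<open>Replacing b by b * r multiplies the numerators by r^(m+1), so the difference
    cancels the denominators and leaves the Taylor series of ln (1 + b). The product then
    telescopes.\<close>
  have step: "exp (logprod b r - logprod (b * r) r) = 1 + b" if b: "norm b < 1" for b
  proof -
    have br: "norm (b * r) < 1"
      using mult_left_le[of "norm r" "norm b"] b assms(2) by (simp add: norm_mult)
    have "(\<lambda>m. (- 1) ^ m / of_nat (Suc m) * b ^ Suc m / (1 - r ^ Suc m)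
          - (- 1) ^ m / of_nat (Suc m) * (b * r) ^ Suc m / (1 - r ^ Suc m)) sums
          (logprod b r - logprod (b * r) r)"
      unfolding logprod_def
      by (intro sums_diff summable_sums summable_logprod b br assms)
    moreover have "(- 1) ^ m / of_nat (Suc m) * b ^ Suc m / (1 - r ^ Suc m)
          - (- 1) ^ m / of_nat (Suc m) * (b * r) ^ Suc m / (1 - r ^ Suc m)
          = (- 1) ^ Suc (Suc m) / of_nat (Suc m) * b ^ Suc m" for m
    proof -
      have "(- 1) ^ m / of_nat (Suc m) * b ^ Suc m / (1 - r ^ Suc m)
          - (- 1) ^ m / of_nat (Suc m) * (b * r) ^ Suc m / (1 - r ^ Suc m)
          = (- 1) ^ m / of_nat (Suc m) * b ^ Suc m * (1 - r ^ Suc m) / (1 - r ^ Suc m)"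
        by (simp add: diff_divide_distrib right_diff_distrib power_mult_distrib mult.assoc del: power_Suc of_nat_Suc)
      also have "\<dots> = (- 1) ^ Suc (Suc m) / of_nat (Suc m) * b ^ Suc m"
        using ne[of m] by (simp del: of_nat_Suc power_Suc) simp
      finally show ?thesis .
    qed
    ultimately have "(\<lambda>m. (- 1) ^ Suc (Suc m) / of_nat (Suc m) * b ^ Suc m) sums
          (logprod b r - logprod (b * r) r)"
      by (simp only:)
    moreover have "(\<lambda>m. (- 1) ^ Suc (Suc m) / of_nat (Suc m) * b ^ Suc m) sums ln (1 + b)"
      using Ln_series[OF b] by (subst sums_Suc_iff) simp
    ultimately have "logprod b r - logprod (b * r) r = ln (1 + b)"
      by (rule sums_unique2)
    moreover have "1 + b \<noteq> 0"
      using b by (metis add.commute add_eq_0_iff norm_minus_cancel norm_one less_irrefl)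
    ultimately show ?thesis by simp
  qed
  show ?thesis
  proof (induction N)
    case (Suc N)
    have "(\<Prod>n<Suc N. 1 + a * r ^ n)
        = exp (logprod a r - logprod (a * r ^ N) r) * exp (logprod (a * r ^ N) r - logprod (a * r ^ N * r) r)"
      using Suc step[OF lt[of N]] by simp
    also have "\<dots> = exp (logprod a r - logprod (a * r ^ Suc N) r)"
      by (simp add: exp_add [symmetric] mult_ac)
    finally show ?case .
  qed simp
qed

lemma prod_tendsto_exp_logprod:
  assumes "norm a < 1" "norm r < 1"
  shows "(\<lambda>N. \<Prod>n<N. 1 + a * r ^ n) \<longlonglongrightarrow> exp (logprod a r)"
proof -
  have le: "norm (a * r ^ n) \<le> norm a" for n
    using assms by (simp add: norm_mult norm_power power_le_one mult_left_le)
  have lim: "(\<lambda>N. norm (a * r ^ N) * (1 / ((1 - norm a) * (1 - norm r)))) \<longlonglongrightarrow> 0"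
    using LIMSEQ_power_zero[OF assms(2)]
    by (intro tendsto_mult_left_zero tendsto_norm_zero tendsto_mult_right_zero)
  have "(\<lambda>N. logprod (a * r ^ N) r) \<longlonglongrightarrow> 0"
  proof (rule Lim_null_comparison[OF _ lim], intro always_eventually allI)
    fix N
    have "norm (logprod (a * r ^ N) r) \<le> norm (a * r ^ N) / ((1 - norm (a * r ^ N)) * (1 - norm r))"
      using le[of N] assms by (intro norm_logprod_le) linarith+
    also have "\<dots> \<le> norm (a * r ^ N) / ((1 - norm a) * (1 - norm r))"
      using le[of N] assms by (intro divide_left_mono mult_mono mult_pos_pos) auto
    finally show "norm (logprod (a * r ^ N) r) \<le> norm (a * r ^ N) * (1 / ((1 - norm a) * (1 - norm r)))"
      by simp
  qed
  from tendsto_exp[OF tendsto_diff[OF tendsto_const this]]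
  show ?thesis
    using prod_eq_exp_logprod[OF assms] by simp
qed

lemma norm_partial_prod_le:
  fixes a r :: complex
  assumes "norm r < 1"
  shows "(\<Prod>n<N. 1 + norm (a * r ^ n)) \<le> exp (norm a / (1 - norm r))"
proof -
  have "(\<Prod>n<N. 1 + norm (a * r ^ n)) \<le> exp (\<Sum>n<N. norm (a * r ^ n))"
    by (rule prod_le_exp_sum) auto
  also have "(\<Sum>n<N. norm (a * r ^ n)) = norm a * (\<Sum>n<N. norm r ^ n)"
    by (simp add: norm_mult norm_power sum_distrib_left)
  also have "(\<Sum>n<N. norm r ^ n) \<le> (\<Sum>n. norm r ^ n)"
    using assms by (intro sum_le_suminf summable_geometric) auto
  also have "\<dots> = 1 / (1 - norm r)"
    using assms by (intro suminf_geometric) auto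
  finally show ?thesis by (simp add: mult_left_mono)
qed

text \<open>Expanding the product, every term other than 1 is dominated by the same term with norms.
  Compared with \<open>norm_logprod_le\<close> the factor 1 / (1 - norm a) disappears, which keeps
  the later constants small.\<close>

lemma norm_exp_logprod_minus_one_le:
  assumes "norm a < 1" "norm r < 1"
  shows "norm (exp (logprod a r) - 1) \<le> exp (norm a / (1 - norm r)) - 1"
proof (rule Lim_bounded)
  show "(\<lambda>N. norm ((\<Prod>n<N. 1 + a * r ^ n) - 1)) \<longlonglongrightarrow> norm (exp (logprod a r) - 1)"
    by (intro tendsto_intros prod_tendsto_exp_logprod assms)
  show "\<forall>N\<ge>0. norm ((\<Prod>n<N. 1 + a * r ^ n) - 1) \<le> exp (norm a / (1 - norm r)) - 1"
    using norm_prod_minus1_le_prod_minus1[of "\<lambda>n. a * r ^ n"] norm_partial_prod_le[OF assms(2), of a]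
    by (smt (verit))
qed

lemma norm_exp_logprod_le:
  assumes "norm a < 1" "norm r < 1"
  shows "norm (exp (logprod a r)) \<le> exp (norm a / (1 - norm r))"
  using norm_exp_logprod_minus_one_le[OF assms] norm_triangle_ineq2[of "exp (logprod a r)" 1]
  by (simp del: norm_exp_eq_Re)

section \<open>Partial fractions and exchange of summation\<close>

text \<open>Differentiating the reflection formula, written for the entire function
  \<open>rGamma\<close>, turns the cotangent into a difference of two Digamma values, each with a
  known series.\<close>

lemma pi_cot_sums:
  fixes z :: complex
  assumes "z \<notin> \<int>"
  shows "(\<lambda>k. 2 * z / (z\<^sup>2 - of_nat (Suc k) ^ 2)) sums (pi * cot (pi * z) - 1 / z)"
proof -
  have z0: "z \<noteq> 0" "1 - z \<noteq> 0" using assms by auto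
  have nz: "z + of_nat k \<noteq> 0" "z - of_nat k \<noteq> 0" "of_nat k - z \<noteq> 0" for k
    using assms by (metis Ints_of_nat Ints_minus add_eq_0_iff2, (metis Ints_of_nat eq_iff_diff_eq_0)+)
  have np: "z \<notin> \<int>\<^sub>\<le>\<^sub>0" "1 - z \<notin> \<int>\<^sub>\<le>\<^sub>0"
    using assms nonpos_Ints_subset_Ints by (auto dest: Ints_diff[OF Ints_1])
  have d1: "((\<lambda>w. rGamma w * rGamma (1 - w)) has_field_derivative
      (- rGamma z * Digamma z) * rGamma (1 - z) + rGamma z * (- rGamma (1 - z) * Digamma (1 - z) * (- 1))) (at z)"
    using np by (auto intro!: derivative_eq_intros simp: algebra_simps)
  have d2: "((\<lambda>w. rGamma w * rGamma (1 - w)) has_field_derivative cos (pi * z)) (at z)"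
    unfolding rGamma_reflection_complex by (auto intro!: derivative_eq_intros)
  have e: "(Digamma (1 - z) - Digamma z) * (rGamma z * rGamma (1 - z)) = cos (pi * z)"
    using DERIV_unique[OF d1 d2] by (simp add: algebra_simps)
  have "sin (pi * z) \<noteq> 0"
    using assms by (auto simp: sin_eq_0)
  with e have dig: "Digamma (1 - z) - Digamma z = pi * cot (pi * z)"
    unfolding rGamma_reflection_complex by (simp add: cot_def field_simps)
  have "(\<lambda>k. inverse (of_nat (Suc k)) - inverse (z + of_nat k)) sums (Digamma z + euler_mascheroni)"
    "(\<lambda>k. inverse (of_nat (Suc k)) - inverse (1 - z + of_nat k)) sums (Digamma (1 - z) + euler_mascheroni)"
    using summable_sums[OF summable_Digamma[OF z0(1)]] summable_sums[OF summable_Digamma[OF z0(2)]]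
    by (auto simp: Digamma_def)
  from sums_diff[OF this(2,1)]
  have s: "(\<lambda>k. 1 / (z + of_nat k) - 1 / (of_nat (Suc k) - z)) sums (pi * cot (pi * z))"
    by (simp add: dig inverse_eq_divide algebra_simps)
  have lim0: "(\<lambda>k. 1 / (z + of_nat k)) \<longlonglongrightarrow> 0"
    by (intro tendsto_divide_0[OF tendsto_const] tendsto_add_filterlim_at_infinity[OF tendsto_const]
        tendsto_of_nat)
  \<comment> \<open>The Digamma series pair 1 / (z + k) with 1 / (k + 1 - z), the cotangent series
    pairs k + 1 with - (k + 1). The partial sums differ by 1 / z and a boundary term that tends to
    0.\<close>
  have "(\<Sum>k<K. 2 * z / (z\<^sup>2 - of_nat (Suc k) ^ 2))
      = (\<Sum>k<K. 1 / (z + of_nat k) - 1 / (of_nat (Suc k) - z)) - 1 / z + 1 / (z + of_nat K)" for K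
  proof (induction K)
    case (Suc K)
    define N :: complex where "N = of_nat (Suc K)"
    have ne: "z + N \<noteq> 0" "N - z \<noteq> 0"
      using nz[of "Suc K"] by (simp_all add: N_def)
    have e: "z\<^sup>2 - N\<^sup>2 = - ((z + N) * (N - z))"
      by (simp add: power2_eq_square algebra_simps)
    have "2 * z / (z\<^sup>2 - N\<^sup>2) = 1 / (z + N) - 1 / (N - z)"
      unfolding e diff_frac_eq[OF ne] by simp
    moreover have "z + of_nat (Suc K) = z + N" by (simp add: N_def)
    ultimately show ?case
      unfolding sum.lessThan_Suc Suc N_def [symmetric] by simp
  qed (use z0 in simp)
  then show ?thesis
    unfolding sums_def
    using tendsto_add[OF tendsto_diff[OF s[unfolded sums_def] tendsto_const[of "1 / z"]] lim0]
    by simp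
qed

lemma imaginary_not_Ints:
  fixes w :: complex
  assumes "Re w > 0"
  shows "\<i> * w \<notin> \<int>"
proof
  assume "\<i> * w \<in> \<int>"
  then obtain k where "\<i> * w = of_int k" by (auto elim: Ints_cases)
  then have "Im (\<i> * w) = 0" by simp
  with assms show False by simp
qed

lemma norm_exp_lt_1: "Re w < 0 \<Longrightarrow> norm (exp w) < 1" for w :: complex
  by simp

lemma exp_neq_1_of_Re_neg: "Re w < 0 \<Longrightarrow> 1 - exp w \<noteq> 0" for w :: complex
  by (metis norm_exp_lt_1 eq_iff_diff_eq_0 less_irrefl norm_one)

text \<open>The cotangent series at i w, times i / 2. The constant pi / 2 of (pi / 2) coth (pi w) is
  split off so that the rest has the shape of a Lambert summand.\<close>

lemma coth_partial_fractions:
  fixes w :: complex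
  assumes "Re w > 0"
  shows "(\<lambda>k. w / (w\<^sup>2 + of_nat (Suc k) ^ 2)) sums
    (pi * (exp (- 2 * pi * w) / (1 - exp (- 2 * pi * w))) + pi / 2 - 1 / (2 * w))"
proof -
  have w0: "w \<noteq> 0" using assms by auto
  define e where "e = exp (- 2 * pi * w)"
  define d where "d = exp (- (pi * w))"
  have ne: "1 - e \<noteq> 0"
    unfolding e_def using assms by (intro exp_neq_1_of_Re_neg) simp
  have ed: "e = d * d" "d \<noteq> 0" by (simp_all add: e_def d_def mult_ac flip: exp_add)
  have id: "exp (\<i> * (pi * (\<i> * w))) = d" "exp (- (\<i> * (pi * (\<i> * w)))) = 1 / d"
    by (simp_all add: d_def exp_minus field_simps)
  have "cot (pi * (\<i> * w)) = - \<i> * ((1 + e) / (1 - e))"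
    using ne ed unfolding cot_def cos_exp_eq sin_exp_eq id
    by (simp add: divide_simps) (simp add: algebra_simps)
  moreover have "1 / (\<i> * w) = - \<i> * (1 / w)"
    using w0 by (simp add: field_simps)
  ultimately have c: "pi * cot (pi * (\<i> * w)) - 1 / (\<i> * w) = - \<i> * (pi * ((1 + e) / (1 - e)) - 1 / w)"
    by (simp only:) (simp add: right_diff_distrib)
  have "(\<lambda>k. (\<i> / 2) * (2 * (\<i> * w) / ((\<i> * w)\<^sup>2 - of_nat (Suc k) ^ 2))) sums
     ((\<i> / 2) * (pi * cot (pi * (\<i> * w)) - 1 / (\<i> * w)))"
    by (intro sums_mult pi_cot_sums imaginary_not_Ints assms)
  also have "(\<i> / 2) * (pi * cot (pi * (\<i> * w)) - 1 / (\<i> * w)) = pi * (e / (1 - e)) + pi / 2 - 1 / (2 * w)"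
    unfolding c using ne w0 by (simp add: field_simps)
  also have "(\<lambda>k. (\<i> / 2) * (2 * (\<i> * w) / ((\<i> * w)\<^sup>2 - of_nat (Suc k) ^ 2)))
      = (\<lambda>k. w / (w\<^sup>2 + of_nat (Suc k) ^ 2))"
  proof
    fix k
    define X where "X = w\<^sup>2 + of_nat (Suc k) ^ 2"
    have "(\<i> * w)\<^sup>2 - of_nat (Suc k) ^ 2 = - X"
      by (simp add: X_def power_mult_distrib)
    then show "(\<i> / 2) * (2 * (\<i> * w) / ((\<i> * w)\<^sup>2 - of_nat (Suc k) ^ 2))
      = w / (w\<^sup>2 + of_nat (Suc k) ^ 2)"
      unfolding X_def [symmetric] by simp
  qed
  finally show ?thesis unfolding e_def .
qed

text \<open>The alternating series is twice the terms with even k + 1 minus all terms, and the even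
  ones form the coth series at w / 2.\<close>

lemma csch_partial_fractions:
  fixes w :: complex
  assumes "Re w > 0"
  shows "(\<lambda>k. (- 1) ^ Suc k * (w / (w\<^sup>2 + of_nat (Suc k) ^ 2))) sums
    (pi * (exp (- pi * w) / (1 - exp (- 2 * pi * w))) - 1 / (2 * w))"
proof -
  define b where "b k = w / (w\<^sup>2 + of_nat (Suc k) ^ 2)" for k
  define u where "u = exp (- pi * w)"
  have w0: "w \<noteq> 0" using assms by auto
  have u2: "exp (- 2 * pi * w) = u * u" by (simp add: u_def mult_ac flip: exp_add)
  have ne: "1 - u \<noteq> 0" "1 - u * u \<noteq> 0"
    unfolding u2 [symmetric] unfolding u_def using assms by (intro exp_neq_1_of_Re_neg; simp)+
  have full: "b sums (pi * (u * u / (1 - u * u)) + pi / 2 - 1 / (2 * w))"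
    using coth_partial_fractions[OF assms] unfolding b_def u2 .
  have "Re (w / 2) > 0" using assms by simp
  from coth_partial_fractions[OF this]
  have half: "(\<lambda>k. w / 2 / ((w / 2)\<^sup>2 + of_nat (Suc k) ^ 2)) sums
     (pi * (u / (1 - u)) + pi / 2 - 1 / w)"
    by (simp add: u_def)
  have "w / 2 / ((w / 2)\<^sup>2 + of_nat (Suc k) ^ 2) = 2 * b (2 * k + 1)" for k
  proof -
    have "(w / 2)\<^sup>2 + of_nat (Suc k) ^ 2 = (w\<^sup>2 + of_nat (Suc (2 * k + 1)) ^ 2) / 4"
      by (simp add: power2_eq_square field_simps)
    then show ?thesis unfolding b_def by (simp only:) simp
  qed
  then have "(\<lambda>k. (\<lambda>n. if odd n then 2 * b n else 0) (2 * k + 1)) sums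
     (pi * (u / (1 - u)) + pi / 2 - 1 / w)"
    using half by (simp only:) simp
  then have "(\<lambda>n. if odd n then 2 * b n else 0) sums (pi * (u / (1 - u)) + pi / 2 - 1 / w)"
    by (subst (asm) sums_mono_reindex) (auto simp: strict_mono_def elim: oddE)
  from sums_diff[OF this full]
  have "(\<lambda>n. (- 1) ^ Suc n * b n) sums
     (pi * (u / (1 - u)) + pi / 2 - 1 / w - (pi * (u * u / (1 - u * u)) + pi / 2 - 1 / (2 * w)))"
    by (rule sums_cong [THEN iffD1, rotated]) auto
  also have "pi * (u / (1 - u)) + pi / 2 - 1 / w - (pi * (u * u / (1 - u * u)) + pi / 2 - 1 / (2 * w))
     = pi * (u / (1 - u) - u * u / (1 - u * u)) - 1 / (2 * w)"
    using w0 by (simp add: algebra_simps)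
  also have "u / (1 - u) - u * u / (1 - u * u) = u / (1 - u * u)"
    using ne by (simp add: divide_simps) (simp add: algebra_simps)
  finally show ?thesis unfolding b_def u_def [symmetric] u2 .
qed

text \<open>Partial fractions turn the logarithms of the Weber functions into double series that converge only
  conditionally; adding up consecutive terms of the alternating index makes them absolutely convergent.\<close>

lemma suminf_swap_paired:
  fixes f :: "nat \<Rightarrow> nat \<Rightarrow> complex"
  assumes le: "\<And>m j. norm (f m (2 * j) + f m (2 * j + 1)) \<le> p m * r j"
    and p: "summable p" "\<And>m. p m \<ge> 0" and r: "summable r" "\<And>m. r m \<ge> 0"
    and A: "\<And>m. f m sums A m" and B: "\<And>n. (\<lambda>m. f m n) sums B n" and "summable B"
  shows "A sums suminf B"
proof -
  define g where "g m j = f m (2 * j) + f m (2 * j + 1)" for m j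
  have pair: "sum h {j * 2..<j * 2 + 2} = h (2 * j) + h (2 * j + 1)" for h :: "nat \<Rightarrow> complex" and j
  proof -
    have "{j * 2..<j * 2 + 2} = {2 * j, 2 * j + 1}" by auto
    then show ?thesis by simp
  qed
  have row: "(g m has_sum A m) UNIV" for m
  proof (rule norm_summable_imp_has_sum)
    show "summable (\<lambda>j. norm (g m j))"
      using le by (intro summable_comparison_test'[OF summable_mult[OF r(1), of "p m"], of 0])
        (simp add: g_def)
    show "g m sums A m"
      unfolding g_def [abs_def] pair [symmetric] by (intro sums_group A) simp
  qed
  have col: "((\<lambda>m. g m j) has_sum (B (2 * j) + B (2 * j + 1))) UNIV" for j
  proof (rule norm_summable_imp_has_sum)
    show "summable (\<lambda>m. norm (g m j))"
      using le by (intro summable_comparison_test'[OF summable_mult2[OF p(1), of "r j"], of 0])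
        (simp add: g_def)
    show "(\<lambda>m. g m j) sums (B (2 * j) + B (2 * j + 1))"
      unfolding g_def by (intro sums_add B)
  qed
  have pr: "norm (p m * r j) = p m * r j" for m j
    using p(2)[of m] r(2)[of j] by simp
  \<comment> \<open>The majorant is a product, so its summability over pairs reduces to that of the
    two factors.\<close>
  have "(\<lambda>x. norm (p (fst x) * r (snd x))) summable_on UNIV \<times> UNIV"
  proof (rule Infinite_Sum.abs_summable_on_Sigma_iff[THEN iffD2], unfold fst_conv snd_conv pr infsum_cmult_right', intro conjI ballI)
    show "(\<lambda>j. p m * r j) summable_on UNIV" for m
      by (rule summable_nonneg_imp_summable_on) (use p r in \<open>auto intro: summable_mult\<close>)
    have "infsum r UNIV \<ge> 0"
      using r(2) by (simp add: infsum_nonneg)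
    then show "(\<lambda>m. norm (p m * infsum r UNIV)) summable_on UNIV"
      by (intro summable_nonneg_imp_summable_on) (use p in \<open>auto intro: summable_mult2\<close>)
  qed
  then have "(\<lambda>x. norm (case x of (m, j) \<Rightarrow> g m j)) summable_on UNIV \<times> UNIV"
  proof (rule Infinite_Sum.abs_summable_on_comparison_test)
    fix x :: "nat \<times> nat"
    show "norm (case x of (m, j) \<Rightarrow> g m j) \<le> norm (p (fst x) * r (snd x))"
      unfolding pr using le by (simp add: g_def case_prod_unfold)
  qed
  then have "(\<lambda>(m, j). g m j) summable_on UNIV \<times> UNIV"
    by (rule abs_summable_summable)
  then obtain S where S: "((\<lambda>(m, j). g m j) has_sum S) (UNIV \<times> UNIV)"
    unfolding summable_on_def by blast
  have "(A has_sum S) UNIV"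
    by (rule has_sum_SigmaD[OF S]) (use row in auto)
  moreover have "((\<lambda>j. B (2 * j) + B (2 * j + 1)) has_sum S) UNIV"
    by (rule has_sum_SigmaD[OF S[THEN has_sum_swap[THEN iffD1]]]) (use col in auto)
  \<comment> \<open>Grouping a convergent series keeps its sum; this undoes the pairing in the
    columns.\<close>
  moreover have "(\<lambda>j. B (2 * j) + B (2 * j + 1)) sums suminf B"
    unfolding pair [symmetric] by (intro sums_group summable_sums \<open>summable B\<close>) simp
  ultimately show ?thesis
    by (metis has_sum_imp_sums sums_unique2)
qed

section \<open>Transformation of the Weber functions\<close>

text \<open>The three Weber functions \<open>\<ff>\<close>, \<open>\<ff>\<^sub>1\<close>, \<open>\<ff>\<^sub>2\<close> at \<open>\<tau> = \<i> z\<close>, so that the upper half plane becomes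
  \<open>Re z > 0\<close>; the maps \<open>\<tau> \<mapsto> - 1 / \<tau>\<close> and \<open>\<tau> \<mapsto> \<tau> - 1\<close> become \<open>z \<mapsto> 1 / z\<close> and \<open>z \<mapsto> z + \<i>\<close>.\<close>

definition weber :: "complex \<Rightarrow> complex" where
  "weber = (\<lambda>z :: complex. exp (pi * z / 24) * exp (logprod (exp (- pi * z)) (exp (- 2 * pi * z))))"

definition weber1 :: "complex \<Rightarrow> complex" where
  "weber1 = (\<lambda>z :: complex. exp (pi * z / 24) * exp (logprod (- exp (- pi * z)) (exp (- 2 * pi * z))))"

definition weber2 :: "complex \<Rightarrow> complex" where
  "weber2 = (\<lambda>z :: complex. sqrt 2 * exp (- pi * z / 12) * exp (logprod (exp (- 2 * pi * z)) (exp (- 2 * pi * z))))"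

text \<open>Summed over n, these are the partial fractions at (m + 1) z divided by m + 1. Exchanging
  m and n amounts to replacing z by 1 / z, and this symmetry is the source of both inversion
  formulas.\<close>

definition lattice_term :: "complex \<Rightarrow> nat \<Rightarrow> nat \<Rightarrow> complex" where
  "lattice_term z m n = z / (of_nat (Suc m) ^ 2 * z\<^sup>2 + of_nat (Suc n) ^ 2)"

text \<open>The denominator factors as (m z + i n)(m z - i n). The real part of a factor controls m
  because Re z > 0, and then its norm controls n.\<close>

lemma lattice_denominator_bound:
  fixes z :: complex
  assumes "Re z > 0"
  obtains c where "c > 0"
    "\<And>m n :: nat. c * real (m + n) ^ 2 \<le> norm (of_nat m ^ 2 * z\<^sup>2 + of_nat n ^ 2)"
proof -
  \<comment> \<open>With N the norm of a factor, m + n <= N + m (1 + norm z) and m <= N / Re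
    z.\<close>
  define L where "L = (1 + norm z) / Re z + 1"
  have L: "L \<ge> 1" using assms by (simp add: L_def)
  have le: "real (m + n) \<le> L * norm (of_nat m * z + s * of_nat n)"
    if s: "s = \<i> \<or> s = - \<i>" for s :: complex and m n :: nat
  proof -
    let ?N = "norm (of_nat m * z + s * of_nat n)"
    have "Re (of_nat m * z + s * of_nat n) = real m * Re z"
      using s by auto
    then have 1: "real m * Re z \<le> ?N"
      using complex_Re_le_cmod by metis
    have "real n = norm (s * of_nat n)"
      using s by (auto simp: norm_mult)
    also have "\<dots> \<le> ?N + norm (of_nat m * z)"
      using norm_triangle_ineq4[of "of_nat m * z + s * of_nat n" "of_nat m * z"] by simp
    also have "norm (of_nat m * z) = real m * norm z"
      by (simp add: norm_mult)
    finally have 2: "real n \<le> ?N + real m * norm z" .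
    have "real m \<le> ?N / Re z"
      using 1 assms by (simp add: pos_le_divide_eq)
    then have "real m * (1 + norm z) \<le> ?N / Re z * (1 + norm z)"
      by (intro mult_right_mono) auto
    then show ?thesis
      using 2 by (simp add: L_def algebra_simps)
  qed
  have "(1 / L\<^sup>2) * real (m + n) ^ 2 \<le> norm (of_nat m ^ 2 * z\<^sup>2 + of_nat n ^ 2)" for m n :: nat
  proof -
    have "of_nat m ^ 2 * z\<^sup>2 + of_nat n ^ 2 = (of_nat m * z + \<i> * of_nat n) * (of_nat m * z + (- \<i>) * of_nat n)"
      by (simp add: power2_eq_square algebra_simps)
    then have "L\<^sup>2 * norm (of_nat m ^ 2 * z\<^sup>2 + of_nat n ^ 2)
      = (L * norm (of_nat m * z + \<i> * of_nat n)) * (L * norm (of_nat m * z + (- \<i>) * of_nat n))"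
      by (simp only: norm_mult power2_eq_square mult_ac)
    moreover have "real (m + n) * real (m + n) \<le> \<dots>"
      using L by (intro mult_mono le) auto
    ultimately show ?thesis
      using L by (simp add: power2_eq_square field_simps)
  qed
  then show ?thesis
    using L by (intro that[of "1 / L\<^sup>2"]) auto
qed

text \<open>Consecutive denominators differ by O(n) only, so the terms differ by O((m + n)^(-3)).
  Splitting the exponent 3 evenly over the two indices leaves a product of summable
  sequences.\<close>

lemma lattice_term_paired_bound:
  fixes z :: complex
  assumes "Re z > 0"
  obtains C where "C \<ge> 0"
    "\<And>m j. norm (lattice_term z m (2 * j) - lattice_term z m (2 * j + 1))
       \<le> C * real (Suc m) powr (- 3 / 2) * real (Suc j) powr (- 3 / 2)"
proof -
  obtain c where c: "c > 0"
    "\<And>m n :: nat. c * real (m + n) ^ 2 \<le> norm (of_nat m ^ 2 * z\<^sup>2 + of_nat n ^ 2)"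
    using lattice_denominator_bound[OF assms] by blast
  have "norm (lattice_term z m (2 * j) - lattice_term z m (2 * j + 1))
       \<le> 2 * norm z / c\<^sup>2 * real (Suc m) powr (- 3 / 2) * real (Suc j) powr (- 3 / 2)" for m j
  proof -
    define M K where "M = Suc m" and "K = 2 * j + 1"
    define D where "D n = of_nat M ^ 2 * z\<^sup>2 + of_nat n ^ 2" for n :: nat
    have D: "c * real (M + n) ^ 2 \<le> norm (D n)" for n unfolding D_def by (rule c)
    have MK: "real (M + K) \<ge> 1" by (simp add: M_def)
    have D0: "D n \<noteq> 0" for n
    proof
      assume "D n = 0"
      moreover have "0 < c * real (M + n) ^ 2" using c(1) by (simp add: M_def)
      ultimately show False using D[of n] by simp
    qed
    have "lattice_term z m (2 * j) - lattice_term z m (2 * j + 1) = z / D K - z / D (Suc K)"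
      by (simp add: lattice_term_def D_def M_def K_def)
    also have "\<dots> = z * (D (Suc K) - D K) / (D K * D (Suc K))"
      using D0 by (simp add: field_simps)
    also have "D (Suc K) - D K = of_nat (2 * K + 1)"
      by (simp add: D_def power2_eq_square algebra_simps)
    finally have "norm (lattice_term z m (2 * j) - lattice_term z m (2 * j + 1))
        = norm z * real (2 * K + 1) / (norm (D K) * norm (D (Suc K)))"
      by (simp only: norm_mult norm_divide norm_of_nat)
    also have "\<dots> \<le> norm z * (2 * real (M + K)) / ((c * real (M + K) ^ 2) * (c * real (M + K) ^ 2))"
    proof (intro frac_le mult_left_mono mult_mono)
      have "c * real (M + K) ^ 2 \<le> c * real (M + Suc K) ^ 2"
        using c(1) by (intro mult_left_mono power_mono) auto
      then show "c * real (M + K) ^ 2 \<le> norm (D (Suc K))"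
        using D[of "Suc K"] by linarith
    qed (use D[of K] c(1) MK in \<open>auto simp: M_def\<close>)
    also have "\<dots> = 2 * norm z / c\<^sup>2 * (1 / real (M + K) ^ 3)"
    proof -
      have "x * (2 * y) / (c * y\<^sup>2 * (c * y\<^sup>2)) = 2 * x / c\<^sup>2 * (1 / y ^ 3)" if "y > 0" for x y :: real
        using that c(1) by (simp add: power2_eq_square power3_eq_cube mult_ac)
      from this[of "real (M + K)" "norm z"] show ?thesis using MK by simp
    qed
    also have "\<dots> \<le> 2 * norm z / c\<^sup>2 * (real M powr (- 3 / 2) * real (Suc j) powr (- 3 / 2))"
    proof (intro mult_left_mono)
      have "real M powr (3 / 2) * real (Suc j) powr (3 / 2) \<le> real (M + K) powr (3 / 2) * real (M + K) powr (3 / 2)"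
        by (intro mult_mono powr_mono2) (auto simp: K_def)
      also have "\<dots> = real (M + K) ^ 3"
        using MK by (simp flip: powr_add add: powr_numeral)
      finally have "1 / real (M + K) ^ 3 \<le> 1 / (real M powr (3 / 2) * real (Suc j) powr (3 / 2))"
        by (intro divide_left_mono mult_pos_pos) (use MK in \<open>auto simp: M_def\<close>)
      then show "1 / real (M + K) ^ 3 \<le> real M powr (- 3 / 2) * real (Suc j) powr (- 3 / 2)"
        by (simp add: powr_minus field_simps)
    qed auto
    finally show ?thesis by (simp add: M_def mult.assoc)
  qed
  then show ?thesis
    by (intro that[of "2 * norm z / c\<^sup>2"]) auto
qed

lemma lattice_term_inverse:
  fixes z :: complex
  assumes "z \<noteq> 0"
  shows "lattice_term (1 / z) m n = lattice_term z n m"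
  using assms by (simp add: lattice_term_def power2_eq_square field_simps del: of_nat_Suc)

text \<open>The alternating sign in n is what makes pairs cancel. The free sign \<open>s\<close>
  will be (- 1) ^ m for \<open>weber\<close> and 1 for the passage from \<open>weber1\<close> to
  \<open>weber2\<close>.\<close>

lemma suminf_lattice_swap:
  fixes z :: complex
  assumes z: "Re z > 0" and s: "\<And>m. norm (s m) \<le> 1"
    and A: "\<And>m. (\<lambda>n. s m * ((- 1) ^ Suc n * lattice_term z m n)) sums A m"
    and B: "\<And>n. (\<lambda>m. s m * ((- 1) ^ Suc n * lattice_term z m n)) sums B n" and "summable B"
  shows "A sums suminf B"
proof -
  obtain C where C: "C \<ge> 0"
    "\<And>m j. norm (lattice_term z m (2 * j) - lattice_term z m (2 * j + 1))
       \<le> C * real (Suc m) powr (- 3 / 2) * real (Suc j) powr (- 3 / 2)"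
    using lattice_term_paired_bound[OF z] by blast
  have sum: "summable (\<lambda>m. real (Suc m) powr (- 3 / 2))"
    by (subst summable_Suc_iff) (simp add: summable_real_powr_iff)
  show ?thesis
  proof (rule suminf_swap_paired[where p = "\<lambda>m. C * real (Suc m) powr (- 3 / 2)" and
        r = "\<lambda>m. real (Suc m) powr (- 3 / 2)", OF _ _ _ _ _ A B \<open>summable B\<close>])
    fix m j
    have "s m * ((- 1) ^ Suc (2 * j) * lattice_term z m (2 * j))
        + s m * ((- 1) ^ Suc (2 * j + 1) * lattice_term z m (2 * j + 1))
        = - s m * (lattice_term z m (2 * j) - lattice_term z m (2 * j + 1))"
      by (simp add: algebra_simps)
    also have "norm \<dots> \<le> 1 * (C * real (Suc m) powr (- 3 / 2) * real (Suc j) powr (- 3 / 2))"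
      unfolding norm_mult norm_minus_cancel by (intro mult_mono s C) auto
    finally show "norm (s m * ((- 1) ^ Suc (2 * j) * lattice_term z m (2 * j))
        + s m * ((- 1) ^ Suc (2 * j + 1) * lattice_term z m (2 * j + 1)))
        \<le> C * real (Suc m) powr (- 3 / 2) * real (Suc j) powr (- 3 / 2)" by simp
  qed (use C sum in \<open>auto intro: summable_mult simp del: of_nat_Suc\<close>)
qed

text \<open>Up to sign, the first part is pi times a summand of the logarithm in
  \<open>weber\<close> or \<open>weber1\<close>; the second, summed over m, supplies the exponential
  prefactors.\<close>

lemma lattice_term_csch_sums:
  fixes z :: complex
  assumes "Re z > 0"
  shows "(\<lambda>n. (- 1) ^ Suc n * lattice_term z m n) sums
     (1 / of_nat (Suc m) * (pi * (exp (- pi * z) ^ Suc m / (1 - exp (- 2 * pi * z) ^ Suc m)))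
        - 1 / (2 * z) * (1 / of_nat (Suc m) ^ 2))"
proof -
  define M :: complex where "M = of_nat (Suc m)"
  have M: "M \<noteq> 0" unfolding M_def by (metis of_nat_neq_0)
  have Re: "Re (M * z) > 0" using assms by (simp add: M_def)
  have z0: "z \<noteq> 0" using assms by auto
  have e: "exp (- pi * (M * z)) = exp (- pi * z) ^ Suc m"
    "exp (- 2 * pi * (M * z)) = exp (- 2 * pi * z) ^ Suc m"
    unfolding M_def by (simp_all only: flip: exp_of_nat_mult) (simp_all add: mult_ac)
  have "(\<lambda>n. 1 / M * ((- 1) ^ Suc n * (M * z / ((M * z)\<^sup>2 + of_nat (Suc n) ^ 2)))) sums
     (1 / M * (pi * (exp (- pi * z) ^ Suc m / (1 - exp (- 2 * pi * z) ^ Suc m)) - 1 / (2 * (M * z))))"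
    using sums_mult[OF csch_partial_fractions[OF Re], of "1 / M"] unfolding e .
  also have "1 / M * (pi * (exp (- pi * z) ^ Suc m / (1 - exp (- 2 * pi * z) ^ Suc m)) - 1 / (2 * (M * z)))
     = 1 / M * (pi * (exp (- pi * z) ^ Suc m / (1 - exp (- 2 * pi * z) ^ Suc m))) - 1 / (2 * z) * (1 / M ^ 2)"
    using M z0 by (simp add: right_diff_distrib power2_eq_square del: power_Suc)
  also have "(\<lambda>n. 1 / M * ((- 1) ^ Suc n * (M * z / ((M * z)\<^sup>2 + of_nat (Suc n) ^ 2))))
     = (\<lambda>n. (- 1) ^ Suc n * lattice_term z m n)"
    using M by (simp add: lattice_term_def power_mult_distrib M_def del: of_nat_Suc)
  finally show ?thesis unfolding M_def .
qed

text \<open>The additional pi / 2 is the constant term of coth. Summed with alternating signs it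
  produces ln 2, and finally the factor sqrt 2 of \<open>weber2\<close>.\<close>

lemma lattice_term_coth_sums:
  fixes z :: complex
  assumes "Re z > 0"
  shows "lattice_term z m sums
     (1 / of_nat (Suc m) * (pi * (exp (- 2 * pi * z) ^ Suc m / (1 - exp (- 2 * pi * z) ^ Suc m)))
        + complex_of_real (pi / 2) * (1 / of_nat (Suc m)) - 1 / (2 * z) * (1 / of_nat (Suc m) ^ 2))"
proof -
  define M :: complex where "M = of_nat (Suc m)"
  have M: "M \<noteq> 0" unfolding M_def by (metis of_nat_neq_0)
  have Re: "Re (M * z) > 0" using assms by (simp add: M_def)
  have z0: "z \<noteq> 0" using assms by auto
  have e: "exp (- 2 * pi * (M * z)) = exp (- 2 * pi * z) ^ Suc m"
    unfolding M_def by (simp_all only: flip: exp_of_nat_mult) (simp_all add: mult_ac)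
  have "(\<lambda>n. 1 / M * (M * z / ((M * z)\<^sup>2 + of_nat (Suc n) ^ 2))) sums
     (1 / M * (pi * (exp (- 2 * pi * z) ^ Suc m / (1 - exp (- 2 * pi * z) ^ Suc m)) + pi / 2 - 1 / (2 * (M * z))))"
    using sums_mult[OF coth_partial_fractions[OF Re], of "1 / M"] unfolding e .
  also have "1 / M * (pi * (exp (- 2 * pi * z) ^ Suc m / (1 - exp (- 2 * pi * z) ^ Suc m)) + pi / 2 - 1 / (2 * (M * z)))
     = 1 / M * (pi * (exp (- 2 * pi * z) ^ Suc m / (1 - exp (- 2 * pi * z) ^ Suc m)))
      + complex_of_real (pi / 2) * (1 / M) - 1 / (2 * z) * (1 / M ^ 2)"
    using M z0 by (simp add: right_diff_distrib distrib_left power2_eq_square mult_ac del: power_Suc)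
  also have "(\<lambda>n. 1 / M * (M * z / ((M * z)\<^sup>2 + of_nat (Suc n) ^ 2))) = lattice_term z m"
    using M by (simp add: lattice_term_def [abs_def] power_mult_distrib M_def del: of_nat_Suc)
  finally show ?thesis unfolding M_def .
qed

section \<open>Inverse-square sums and the two inversion formulas\<close>

lemma inverse_squares_sums_complex: "(\<lambda>m. 1 / of_nat (Suc m) ^ 2) sums (complex_of_real (pi\<^sup>2 / 6))"
  using sums_of_real[OF inverse_squares_sums, where ?'a = complex] by (simp add: add.commute)

lemma alternating_inverse_squares_sums_complex:
  "(\<lambda>m. (- 1) ^ m * (1 / of_nat (Suc m) ^ 2)) sums (complex_of_real (pi\<^sup>2 / 12))"
proof -
  define b :: "nat \<Rightarrow> complex" where "b m = 1 / of_nat (Suc m) ^ 2" for m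
  have full: "b sums (complex_of_real (pi\<^sup>2 / 6))"
    unfolding b_def by (rule inverse_squares_sums_complex)
  have eq: "2 * b (Suc (2 * k)) = b k / 2" for k
  proof -
    have "complex_of_nat (Suc (Suc (2 * k))) = 2 * of_nat (Suc k)" by simp
    then show ?thesis unfolding b_def by (simp only:) (simp add: power2_eq_square del: of_nat_Suc)
  qed
  have "(\<lambda>k. (\<lambda>n. if odd n then 2 * b n else 0) (2 * k + 1)) sums (complex_of_real (pi\<^sup>2 / 6) / 2)"
    using sums_divide[OF full, of 2] by (simp add: eq)
  then have "(\<lambda>n. if odd n then 2 * b n else 0) sums (complex_of_real (pi\<^sup>2 / 6) / 2)"
    by (subst (asm) sums_mono_reindex) (auto simp: strict_mono_def elim: oddE)
  from sums_diff[OF full this]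
  have "(\<lambda>n. (- 1) ^ n * b n) sums (complex_of_real (pi\<^sup>2 / 6) - complex_of_real (pi\<^sup>2 / 6) / 2)"
    by (rule sums_cong [THEN iffD1, rotated]) auto
  then show ?thesis unfolding b_def by simp
qed

lemma logprod_sums:
  assumes "norm a < 1" "norm r < 1"
  shows "(\<lambda>m. (- 1) ^ m * (1 / of_nat (Suc m) * (a ^ Suc m / (1 - r ^ Suc m)))) sums logprod a r"
  using summable_sums[OF summable_logprod[OF assms]] by (simp add: logprod_def)

text \<open>With the sign (- 1) ^ (m + n + 1) the lattice sum is symmetric in m and n up to z -> 1 /
  z. Its two iterated sums, divided by pi, are the logarithms of the products at z and 1 / z, less
  pi / (24 z) and pi z / 24.\<close>

lemma weber_inverse:
  fixes z :: complex
  assumes "Re z > 0"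
  shows "weber (1 / z) = weber z"
proof -
  have z0: "z \<noteq> 0" using assms by auto
  have Re': "Re (1 / z) > 0"
    using assms z0 by (simp add: Re_divide zero_less_divide_iff sum_power2_gt_zero_iff complex_eq_iff)
  define L where "L z = logprod (exp (- pi * z)) (exp (- 2 * pi * z))" for z :: complex
  define A where "A z m = (- 1) ^ m * (1 / of_nat (Suc m) * (pi * (exp (- pi * z) ^ Suc m / (1 - exp (- 2 * pi * z) ^ Suc m)))
        - 1 / (2 * z) * (1 / of_nat (Suc m) ^ 2))" for z :: complex and m
  have A: "A z sums (pi * L z - 1 / (2 * z) * (pi\<^sup>2 / 12))" if "Re z > 0" for z :: complex
  proof -
    have "(\<lambda>m. pi * ((- 1) ^ m * (1 / of_nat (Suc m) * (exp (- pi * z) ^ Suc m / (1 - exp (- 2 * pi * z) ^ Suc m))))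
      - 1 / (2 * z) * ((- 1) ^ m * (1 / of_nat (Suc m) ^ 2))) sums (pi * L z - 1 / (2 * z) * of_real (pi\<^sup>2 / 12))"
      unfolding L_def using that
      by (intro sums_diff sums_mult logprod_sums alternating_inverse_squares_sums_complex) auto
    then show ?thesis
      unfolding A_def by (simp add: algebra_simps del: power_Suc of_nat_Suc)
  qed
  have "A z sums suminf (A (1 / z))"
  proof (rule suminf_lattice_swap[OF assms, of "\<lambda>m. (- 1) ^ m"])
    show "(\<lambda>n. (- 1) ^ m * ((- 1) ^ Suc n * lattice_term z m n)) sums A z m" for m
      unfolding A_def by (intro sums_mult lattice_term_csch_sums assms)
    show "(\<lambda>m. (- 1) ^ m * ((- 1) ^ Suc n * lattice_term z m n)) sums A (1 / z) n" for n
      using sums_mult[OF lattice_term_csch_sums[OF Re', of n], of "(- 1) ^ n"]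
      unfolding A_def lattice_term_inverse[OF z0] by (simp add: mult_ac)
    show "summable (A (1 / z))"
      using A[OF Re'] by (rule sums_summable)
  qed (simp add: norm_power)
  then have "pi * L z - 1 / (2 * z) * (pi\<^sup>2 / 12) = pi * L (1 / z) - 1 / (2 * (1 / z)) * (pi\<^sup>2 / 12)"
    using A[OF assms] A[OF Re'] by (metis sums_unique sums_unique2)
  then have "complex_of_real pi * (L z - pi / (24 * z)) = pi * (L (1 / z) - pi * z / 24)"
    by (simp add: algebra_simps power2_eq_square)
  then have "L z - pi / (24 * z) = L (1 / z) - pi * z / 24"
    by simp
  then have "pi * z / 24 + L z = pi * (1 / z) / 24 + L (1 / z)"
    by (simp add: algebra_simps)
  then show ?thesis
    unfolding weber_def L_def [symmetric] exp_add [symmetric] by simp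
qed

text \<open>With the sign in n alone the symmetry is broken: the rows are csch sums and give
  \<open>weber1\<close> at z, the columns are coth sums and give \<open>weber2\<close> at 1 /
  z.\<close>

lemma weber1_eq_weber2_inverse:
  fixes z :: complex
  assumes "Re z > 0"
  shows "weber1 z = weber2 (1 / z)"
proof -
  have z0: "z \<noteq> 0" using assms by auto
  define w where "w = 1 / z"
  have Re': "Re w > 0" unfolding w_def
    using assms z0 by (simp add: Re_divide zero_less_divide_iff sum_power2_gt_zero_iff complex_eq_iff)
  define L1 where "L1 = logprod (- exp (- pi * z)) (exp (- 2 * pi * z))"
  define L2 where "L2 = logprod (exp (- 2 * pi * w)) (exp (- 2 * pi * w))"
  define A where "A m = 1 / of_nat (Suc m) * (pi * (exp (- pi * z) ^ Suc m / (1 - exp (- 2 * pi * z) ^ Suc m)))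
        - 1 / (2 * z) * (1 / of_nat (Suc m) ^ 2)" for m
  define B where "B n = (- 1) ^ Suc n * (1 / of_nat (Suc n) * (pi * (exp (- 2 * pi * w) ^ Suc n / (1 - exp (- 2 * pi * w) ^ Suc n)))
        + complex_of_real (pi / 2) * (1 / of_nat (Suc n)) - 1 / (2 * w) * (1 / of_nat (Suc n) ^ 2))" for n
  have A: "A sums (- pi * L1 - 1 / (2 * z) * (pi\<^sup>2 / 6))"
  proof -
    have "(\<lambda>m. - pi * ((- 1) ^ m * (1 / of_nat (Suc m) * ((- exp (- pi * z)) ^ Suc m / (1 - exp (- 2 * pi * z) ^ Suc m))))
      - 1 / (2 * z) * (1 / of_nat (Suc m) ^ 2)) sums (- pi * L1 - 1 / (2 * z) * of_real (pi\<^sup>2 / 6))"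
      unfolding L1_def using assms
      by (intro sums_diff sums_mult logprod_sums inverse_squares_sums_complex) auto
    moreover have "(- 1) ^ m * (c * ((- x) ^ Suc m / d)) = - (c * (x ^ Suc m / d))" for c x d :: complex and m
    proof -
      have "(- 1) ^ m * (c * ((- x) ^ Suc m / d)) = ((- 1) ^ m * (- 1) ^ m) * (- (c * (x ^ Suc m / d)))"
        unfolding power_minus[of x "Suc m"] by simp
      then show ?thesis by (simp flip: power_mult_distrib)
    qed
    ultimately show ?thesis
      unfolding A_def by (simp add: algebra_simps del: power_Suc of_nat_Suc)
  qed
  have ln2: "(\<lambda>n. (- 1) ^ n * (1 / of_nat (Suc n))) sums complex_of_real (ln 2)"
    using sums_of_real[OF alternating_harmonic_series_sums, where ?'a = complex] by simp
  have B: "B sums (- (pi * L2 + complex_of_real (pi / 2) * complex_of_real (ln 2) - 1 / (2 * w) * (pi\<^sup>2 / 12)))"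
  proof -
    have "(\<lambda>n. - (pi * ((- 1) ^ n * (1 / of_nat (Suc n) * (exp (- 2 * pi * w) ^ Suc n / (1 - exp (- 2 * pi * w) ^ Suc n))))
      + complex_of_real (pi / 2) * ((- 1) ^ n * (1 / of_nat (Suc n)))
      - 1 / (2 * w) * ((- 1) ^ n * (1 / of_nat (Suc n) ^ 2)))) sums
       - (pi * L2 + complex_of_real (pi / 2) * of_real (ln 2) - 1 / (2 * w) * of_real (pi\<^sup>2 / 12))"
      unfolding L2_def using Re'
      by (intro sums_minus sums_diff sums_add sums_mult logprod_sums alternating_inverse_squares_sums_complex ln2) auto
    then show ?thesis
      unfolding B_def
      by (simp add: algebra_simps del: power_Suc of_nat_Suc) (simp add: algebra_simps del: of_nat_Suc)
  qed
  have "A sums suminf B"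
  proof (rule suminf_lattice_swap[OF assms, of "\<lambda>m. 1"])
    show "(\<lambda>n. 1 * ((- 1) ^ Suc n * lattice_term z m n)) sums A m" for m
      unfolding A_def mult_1 by (intro lattice_term_csch_sums assms)
    show "(\<lambda>m. 1 * ((- 1) ^ Suc n * lattice_term z m n)) sums B n" for n
      unfolding B_def mult_1 lattice_term_inverse[OF z0, symmetric, folded w_def]
      by (intro sums_mult lattice_term_coth_sums Re')
    show "summable B"
      using B by (rule sums_summable)
  qed simp
  then have "- pi * L1 - 1 / (2 * z) * (pi\<^sup>2 / 6) = - (pi * L2 + complex_of_real (pi / 2) * complex_of_real (ln 2) - 1 / (2 * w) * (pi\<^sup>2 / 12))"
    using A B by (metis sums_unique sums_unique2)
  moreover have w': "1 / (2 * w) = z / 2"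
    by (simp add: w_def)
  ultimately have "complex_of_real pi * (L1 + pi / (12 * z)) = pi * (L2 + complex_of_real (ln 2) / 2 - pi * z / 24)"
    using z0 unfolding w' by (simp add: field_simps power2_eq_square)
  then have "L1 + pi / (12 * z) = L2 + complex_of_real (ln 2) / 2 - pi * z / 24"
    by simp
  then have "pi * z / 24 + L1 = complex_of_real (ln 2) / 2 + (- pi * w / 12 + L2)"
    by (simp add: algebra_simps w_def)
  moreover have "exp (complex_of_real (ln 2) / 2) = sqrt 2"
  proof -
    have "exp (ln 2 / 2) = sqrt 2" by (simp add: ln_sqrt [symmetric])
    then show ?thesis by (metis exp_of_real of_real_divide of_real_numeral)
  qed
  moreover have "weber1 z = exp (pi * z / 24 + L1)" "weber2 w = sqrt 2 * exp (- pi * w / 12 + L2)"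
    unfolding weber1_def weber2_def L1_def L2_def exp_add by (simp_all only: mult.assoc)
  ultimately have "weber1 z = weber2 w"
    by (simp only: exp_add mult.assoc)
  then show ?thesis unfolding w_def .
qed

section \<open>Reduction of the Weber functions to a fundamental domain\<close>

lemma exp_shift_i:
  fixes z :: complex
  shows "exp (- pi * (z + \<i>)) = - exp (- pi * z)" "exp (- 2 * pi * (z + \<i>)) = exp (- 2 * pi * z)"
proof -
  show 1: "exp (- pi * (z + \<i>)) = - exp (- pi * z)" for z :: complex
    by (simp add: distrib_left exp_add exp_diff exp_minus mult_ac)
  have "exp (- 2 * pi * w) = exp (- pi * w) ^ 2" for w :: complex
    by (simp add: mult_ac flip: exp_double)
  then show "exp (- 2 * pi * (z + \<i>)) = exp (- 2 * pi * z)"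
    using 1 by simp
qed

text \<open>The sign change of exp (- pi z) exchanges \<open>weber\<close> and
  \<open>weber1\<close>. Only norms are compared, because the prefactors change by 48th roots of
  unity.\<close>

lemma norm_weber_shift:
  "norm (weber (z + \<i>)) = norm (weber1 z)"
  "norm (weber1 (z + \<i>)) = norm (weber z)"
  "norm (weber2 (z + \<i>)) = norm (weber2 z)"
  unfolding weber_def weber1_def weber2_def exp_shift_i by (simp_all add: norm_mult)

lemma exp_minus_half_pi_bounds:
  assumes "X \<ge> (1 / 2 :: real)"
  shows "exp (- pi * X) \<le> 2261 / 10000" "exp (- 2 * pi * X) \<le> (2261 / 10000)\<^sup>2"
proof -
  \<comment> \<open>The quadratic Taylor value 41 / 32 at 1 / 4 has a sixth power below exp (3 / 2),
    and (32 / 41)^6 is just below 2261 / 10000.\<close>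
  have "1 + 1 / 4 + (1 / 4)\<^sup>2 / 2 \<le> exp (1 / 4 :: real)"
    by (rule exp_lower_Taylor_quadratic) simp
  then have "41 / 32 \<le> exp (1 / 4 :: real)" by (simp add: power2_eq_square)
  then have "(41 / 32) ^ 6 \<le> exp (1 / 4 :: real) ^ 6"
    by (intro power_mono) auto
  also have "\<dots> = exp (3 / 2)" by (simp flip: exp_of_nat_mult)
  finally have "inverse (exp (3 / 2)) \<le> inverse ((41 / 32) ^ 6 :: real)"
    by (intro le_imp_inverse_le) auto
  then have e: "exp (- (3 / 2)) \<le> (2261 / 10000 :: real)"
    by (simp add: exp_minus power_divide)
  have "3 * (1 / 2) \<le> pi * X"
    using assms pi_gt3 by (intro mult_mono) auto
  then have "exp (- pi * X) \<le> exp (- (3 / 2))" by simp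
  then show 1: "exp (- pi * X) \<le> 2261 / 10000" using e by linarith
  have "exp (- 2 * pi * X) = exp (- pi * X) ^ 2"
    by (simp add: mult_ac flip: exp_double)
  also have "\<dots> \<le> (2261 / 10000)\<^sup>2" by (intro power_mono 1) auto
  finally show "exp (- 2 * pi * X) \<le> (2261 / 10000)\<^sup>2" .
qed

lemma exp_logprod_bounds:
  fixes z a :: complex
  assumes z: "Re z \<ge> 1 / 2" and a: "norm a = exp (- pi * Re z)"
  shows "norm (exp (logprod a (exp (- 2 * pi * z)))) \<le> 13 / 10" (is "norm (exp ?L) \<le> _")
    and "norm (exp (logprod a (exp (- 2 * pi * z))) - 1) \<le> 2 * exp (- pi * Re z)"
proof -
  define e where "e = exp (- pi * Re z)"
  define r where "r = exp (- 2 * pi * Re z)"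
  have e: "0 < e" "e \<le> 2261 / 10000" and r: "0 < r" "r \<le> (2261 / 10000)\<^sup>2"
    using exp_minus_half_pi_bounds[OF z] by (auto simp: e_def r_def)
  have nr: "norm (exp (- 2 * pi * z)) = r" by (simp add: r_def)
  have na: "norm a = e" using a by (simp add: e_def)
  \<comment> \<open>From s <= 0.239 follows exp s - 1 <= 1.239 s. This is below 0.3, whence 13 / 10,
    and below 1.31 e, whence the factor 2.\<close>
  define s where "s = e / (1 - r)"
  have "s \<le> e / (1 - (2261 / 10000)\<^sup>2)"
    unfolding s_def using e r by (intro divide_left_mono mult_pos_pos) (auto simp: power2_eq_square)
  then have s1: "s \<le> e * (1055 / 1000)" using e by (simp add: power2_eq_square)
  have s0: "s \<ge> 0" unfolding s_def using e r by (auto simp: power2_eq_square)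
  have s2: "s \<le> 239 / 1000" using s1 e by linarith
  have "exp s \<le> 1 + s + s\<^sup>2" using s0 s2 by (intro exp_bound) auto
  moreover have "s\<^sup>2 \<le> (239 / 1000) * s" unfolding power2_eq_square using s0 s2 by (intro mult_right_mono)
  ultimately have es: "exp s - 1 \<le> 1239 / 1000 * s" by simp
  have le: "norm (exp ?L - 1) \<le> exp s - 1"
    using norm_exp_logprod_minus_one_le[of a "exp (- 2 * pi * z)"] e r
    unfolding nr na s_def by (auto simp: power2_eq_square)
  show "norm (exp ?L - 1) \<le> 2 * exp (- pi * Re z)"
    using le es s1 e unfolding e_def [symmetric] by linarith
  have "norm (exp ?L) \<le> norm (exp ?L - 1) + 1"
    using norm_triangle_ineq[of "exp ?L - 1" 1] by (simp del: norm_exp_eq_Re)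
  then show "norm (exp ?L) \<le> 13 / 10" using le es s2 by linarith
qed

text \<open>The flag says that the function is carried to \<open>weber2\<close>, the only one of the
  three that decays as the height grows; the other two grow like exp (pi Y / 24).\<close>

definition cusp_bound :: "bool \<Rightarrow> real \<Rightarrow> real" where
  "cusp_bound b Y = (if b then 3 / 2 else 13 / 10 * exp (pi * Y / 24))"

lemma weber_bounds_base:
  assumes "Re z \<ge> 1 / 2"
  shows "norm (weber z) \<le> cusp_bound False (Re z)"
    "norm (weber1 z) \<le> cusp_bound False (Re z)"
    "norm (weber2 z) \<le> cusp_bound True (Re z)"
proof -
  have "norm (exp (pi * z / 24)) * norm (exp (logprod a (exp (- 2 * pi * z)))) \<le> exp (pi * Re z / 24) * (13 / 10)"
    if "norm a = exp (- pi * Re z)" for a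
    using exp_logprod_bounds(1)[OF assms that] by (intro mult_mono) auto
  from this[of "exp (- pi * z)"] this[of "- exp (- pi * z)"]
  show "norm (weber z) \<le> cusp_bound False (Re z)" "norm (weber1 z) \<le> cusp_bound False (Re z)"
    by (simp_all add: weber_def weber1_def cusp_bound_def norm_mult)
  define r where "r = exp (- 2 * pi * Re z)"
  have r: "0 < r" "r \<le> (2261 / 10000)\<^sup>2"
    using exp_minus_half_pi_bounds[OF assms] by (auto simp: r_def)
  have nr: "norm (exp (- 2 * pi * z)) = r" by (simp add: r_def)
  have s: "r / (1 - r) \<le> 54 / 1000" "r / (1 - r) \<ge> 0"
    using r by (auto simp: divide_simps power2_eq_square)
  have "norm (exp (logprod (exp (- 2 * pi * z)) (exp (- 2 * pi * z)))) \<le> exp (r / (1 - r))"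
    using norm_exp_logprod_le[of "exp (- 2 * pi * z)" "exp (- 2 * pi * z)"] r unfolding nr
    by (auto simp: power2_eq_square)
  also have "\<dots> \<le> 1 + r / (1 - r) + (r / (1 - r))\<^sup>2"
    using s by (intro exp_bound) linarith+
  also have "(r / (1 - r))\<^sup>2 \<le> (54 / 1000)\<^sup>2" using s by (intro power_mono) auto
  finally have 1: "norm (exp (logprod (exp (- 2 * pi * z)) (exp (- 2 * pi * z)))) \<le> 1057 / 1000"
    using s by (simp add: power2_eq_square)
  have 2: "norm (exp (- pi * z / 12)) \<le> 1" using assms by simp
  have 3: "sqrt 2 \<le> 1415 / 1000" by (rule real_le_lsqrt) (auto simp: power2_eq_square)
  have "norm (weber2 z) = sqrt 2 * norm (exp (- pi * z / 12)) * norm (exp (logprod (exp (- 2 * pi * z)) (exp (- 2 * pi * z))))"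
    unfolding weber2_def norm_mult by simp
  also have "\<dots> \<le> 1415 / 1000 * 1 * (1057 / 1000)"
    by (intro mult_mono 1 2 3) auto
  finally show "norm (weber2 z) \<le> cusp_bound True (Re z)" by (simp add: cusp_bound_def)
qed

text \<open>The product factor is 1 + O(exp (- pi Re z)), which outweighs the growth exp (pi Re z /
  24) of the prefactor.\<close>

lemma weber1_approx:
  fixes z :: complex
  assumes "Re z \<ge> 1 / 2"
  shows "norm (weber1 z - exp (pi * z / 24)) \<le> 2"
proof -
  have "weber1 z - exp (pi * z / 24) = exp (pi * z / 24) * (exp (logprod (- exp (- pi * z)) (exp (- 2 * pi * z))) - 1)"
    by (simp add: weber1_def algebra_simps)
  also have "norm \<dots> \<le> exp (pi * Re z / 24) * (2 * exp (- pi * Re z))"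
    unfolding norm_mult using exp_logprod_bounds(2)[OF assms, of "- exp (- pi * z)"]
    by (intro mult_mono) auto
  also have "\<dots> = 2 * exp (pi * Re z / 24 + - pi * Re z)"
    unfolding exp_add by simp
  also have "pi * Re z / 24 + - pi * Re z \<le> 0" using assms by (simp add: field_simps)
  then have "2 * exp (pi * Re z / 24 + - pi * Re z) \<le> 2" by simp
  finally show ?thesis .
qed

text \<open>With \<open>\<tau> = \<i> z\<close> the pair \<open>(c, d)\<close> is the bottom row of a matrix of the modular group that moves
  \<open>\<tau>\<close> to a point of imaginary part \<open>Re z / \<bar>c \<tau> + d\<bar>\<^sup>2\<close>.  Modulo 2 this row determines into which of
  the three functions a given one is turned, so only that parity has to be recorded.\<close>

definition cusp_height :: "complex \<Rightarrow> int \<Rightarrow> int \<Rightarrow> real" where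
  "cusp_height z c d = Re z / (norm (of_int d + \<i> * of_int c * z))\<^sup>2"

text \<open>All three bounds share one pair (c, d): the generators permute the functions, so a claim
  about \<open>weber2\<close> alone would not survive the induction. For coprime c and d exactly one
  of c, d, c + d is even, and it marks the function carried to \<open>weber2\<close>.\<close>

definition cusp_bounded :: "complex \<Rightarrow> bool" where
  "cusp_bounded z \<longleftrightarrow> (\<exists>c d. coprime c d \<and> cusp_height z c d \<ge> 1 / 2 \<and>
     norm (weber2 z) \<le> cusp_bound (even c) (cusp_height z c d) \<and>
     norm (weber1 z) \<le> cusp_bound (even d) (cusp_height z c d) \<and>
     norm (weber z) \<le> cusp_bound (even (c + d)) (cusp_height z c d))"

lemma cusp_bounded_base:
  assumes "Re z \<ge> 1 / 2"
  shows "cusp_bounded z"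
proof -
  have "cusp_height z 0 1 = Re z" by (simp add: cusp_height_def)
  then show ?thesis
    unfolding cusp_bounded_def using assms weber_bounds_base[OF assms]
    by - (rule exI[of _ 0], rule exI[of _ 1], simp)
qed

text \<open>The row (c, d) at z + i becomes (c, d - c) at z. This exchanges the parities of d and c
  + d, as the shift exchanges the norms of \<open>weber1\<close> and \<open>weber\<close>.\<close>

lemma cusp_bounded_shift: "cusp_bounded (z + \<i>) \<longleftrightarrow> cusp_bounded z"
proof -
  have h: "cusp_height (z + \<i>) c d = cusp_height z c (d - c)" for c d
  proof -
    have "of_int d + \<i> * of_int c * (z + \<i>) = of_int (d - c) + \<i> * of_int c * z"
      by (simp add: algebra_simps)
    then show ?thesis unfolding cusp_height_def by (simp only:) simp
  qed
  have cop: "coprime c (d - c) \<longleftrightarrow> coprime c d" for c d :: int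
  proof -
    have "k dvd d - c \<longleftrightarrow> k dvd d" if "k dvd c" for k
      using that by (metis diff_add_cancel dvd_add dvd_diff)
    then show ?thesis unfolding coprime_def by blast
  qed
  show ?thesis
  proof
    assume "cusp_bounded (z + \<i>)"
    then obtain c d where "coprime c d" "cusp_height (z + \<i>) c d \<ge> 1 / 2"
      "norm (weber2 (z + \<i>)) \<le> cusp_bound (even c) (cusp_height (z + \<i>) c d)"
      "norm (weber1 (z + \<i>)) \<le> cusp_bound (even d) (cusp_height (z + \<i>) c d)"
      "norm (weber (z + \<i>)) \<le> cusp_bound (even (c + d)) (cusp_height (z + \<i>) c d)"
      unfolding cusp_bounded_def by blast
    moreover have "even (d - c) = even (c + d)" "even (c + (d - c)) = even d" by auto
    ultimately show "cusp_bounded z"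
      unfolding cusp_bounded_def norm_weber_shift h
      by - (rule exI[of _ c], rule exI[of _ "d - c"], simp only: cop simp_thms)
  next
    assume "cusp_bounded z"
    then obtain c d where "coprime c d" "cusp_height z c d \<ge> 1 / 2"
      "norm (weber2 z) \<le> cusp_bound (even c) (cusp_height z c d)"
      "norm (weber1 z) \<le> cusp_bound (even d) (cusp_height z c d)"
      "norm (weber z) \<le> cusp_bound (even (c + d)) (cusp_height z c d)"
      unfolding cusp_bounded_def by blast
    moreover have "even (d + c) = even (c + d)" "even (c + (d + c)) = even d" "d + c - c = d" by auto
    ultimately show "cusp_bounded (z + \<i>)"
      unfolding cusp_bounded_def norm_weber_shift h
      by - (rule exI[of _ c], rule exI[of _ "d + c"], simp only: simp_thms cop[of c "d + c", symmetric])
  qed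
qed

lemma cusp_bounded_shift_int: "cusp_bounded (z + of_int k * \<i>) \<longleftrightarrow> cusp_bounded z"
proof (induction k rule: int_induct[of _ 0])
  case (step1 i)
  then show ?case using cusp_bounded_shift[of "z + of_int i * \<i>"] by (simp add: algebra_simps)
next
  case (step2 i)
  then show ?case using cusp_bounded_shift[of "z + of_int (i - 1) * \<i>"] by (simp add: algebra_simps)
qed simp

text \<open>The row (c, d) at 1 / z becomes (- d, c) at z. This exchanges the parities of c and d,
  as inversion exchanges \<open>weber2\<close> and \<open>weber1\<close>.\<close>

lemma cusp_bounded_inverse:
  assumes z: "Re z > 0" and "cusp_bounded (1 / z)"
  shows "cusp_bounded z"
proof -
  from z have z0: "z \<noteq> 0" by auto
  obtain c d where cd: "coprime c d" "cusp_height (1 / z) c d \<ge> 1 / 2"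
      "norm (weber2 (1 / z)) \<le> cusp_bound (even c) (cusp_height (1 / z) c d)"
      "norm (weber1 (1 / z)) \<le> cusp_bound (even d) (cusp_height (1 / z) c d)"
      "norm (weber (1 / z)) \<le> cusp_bound (even (c + d)) (cusp_height (1 / z) c d)"
    using assms(2) unfolding cusp_bounded_def by blast
  have Re': "Re (1 / z) > 0"
    using z z0 by (simp add: Re_divide zero_less_divide_iff sum_power2_gt_zero_iff complex_eq_iff)
  have w: "weber (1 / z) = weber z" "weber2 (1 / z) = weber1 z" "weber1 (1 / z) = weber2 z"
    using weber_inverse[OF z] weber1_eq_weber2_inverse[OF z] weber1_eq_weber2_inverse[OF Re'] by simp_all
  have "of_int c + \<i> * of_int (- d) * z = - \<i> * z * (of_int d + \<i> * of_int c * (1 / z))"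
    using z0 by (simp add: algebra_simps)
  then have "norm (of_int c + \<i> * of_int (- d) * z) = norm z * norm (of_int d + \<i> * of_int c * (1 / z))"
    by (simp add: norm_mult)
  moreover have "Re (1 / z) = Re z / (norm z)\<^sup>2"
    by (simp add: Re_divide cmod_power2)
  ultimately have h: "cusp_height (1 / z) c d = cusp_height z (- d) c"
    by (simp add: cusp_height_def power_mult_distrib)
  show ?thesis
    unfolding cusp_bounded_def
    by (rule exI[of _ "- d"], rule exI[of _ c]) (use cd in \<open>simp add: w h coprime_commute\<close>)
qed

text \<open>Below height 1/2, a point translated to |Im| <= 1/2 has squared norm below 1/2, so
  inversion more than doubles its real part. Stopping at 1/2 rather than at sqrt 3 / 2 is what gives
  this fixed gain per step.\<close>

lemma cusp_bounded:
  assumes "Re z > 0"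
  shows "cusp_bounded z"
proof -
  obtain k where k: "(1 / 2) ^ k < 2 * Re z"
    using real_arch_pow_inv[of "2 * Re z" "1 / 2"] assms by auto
  have "Re z > (1 / 2) ^ Suc k" using k by simp
  then show ?thesis
  proof (induction k arbitrary: z)
    case 0
    then show ?case by (intro cusp_bounded_base) simp
  next
    case (Suc k z)
    show ?case
    proof (cases "Re z \<ge> 1 / 2")
      case False
      define w where "w = z + of_int (- round (Im z)) * \<i>"
      have Im: "\<bar>Im w\<bar> \<le> 1 / 2"
        using of_int_round_abs_le[of "Im z"] by (simp add: w_def abs_minus_commute)
      have Re: "Re w = Re z" by (simp add: w_def)
      have pos: "Re z > 0" by (rule less_trans[OF _ Suc.prems]) simp
      have "(Im w)\<^sup>2 \<le> (1 / 2)\<^sup>2" using Im by (metis abs_ge_zero power2_abs power_mono)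
      moreover have "(Re w)\<^sup>2 < (1 / 2)\<^sup>2" using False pos Re by (intro power_strict_mono) auto
      ultimately have "(norm w)\<^sup>2 < 1 / 2" unfolding cmod_power2 by (simp add: power2_eq_square)
      moreover have "(norm w)\<^sup>2 > 0" using pos Re by auto
      ultimately have "Re w * 2 < Re w / (norm w)\<^sup>2"
        using pos Re mult_strict_left_mono[of "(norm w)\<^sup>2" "1 / 2" "2 * Re w"]
        by (simp add: pos_less_divide_eq mult_ac)
      then have "Re (1 / w) > 2 * Re z"
        using Re by (simp add: Re_divide cmod_power2)
      then have "Re (1 / w) > (1 / 2) ^ Suc k" using Suc.prems by simp
      then have "cusp_bounded (1 / w)" by (rule Suc.IH)
      then have "cusp_bounded w" by (rule cusp_bounded_inverse[rotated]) (use pos Re in simp)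
      then show ?thesis unfolding w_def by (simp only: cusp_bounded_shift_int)
    qed (rule cusp_bounded_base)
  qed
qed

section \<open>The number of partitions into distinct parts as an integral\<close>

lemma integral_exp_period:
  fixes y :: real and k :: int
  shows "((\<lambda>x. exp (2 * pi * of_int k * Complex y x)) has_integral (if k = 0 then 1 else 0)) {- 1 / 2..1 / 2}"
proof (cases "k = 0")
  case True
  then show ?thesis
    using has_integral_const_real[of "1 :: complex" "- 1 / 2" "1 / 2"] by simp
next
  case False
  define c :: complex where "c = 2 * pi * of_int k"
  have c: "c \<noteq> 0" using False by (simp add: c_def)
  define F where "F x = exp (c * Complex y x) / (c * \<i>)" for x
  have F: "(F has_vector_derivative exp (c * Complex y x)) (at x within A)" for x A
  proof -
    have "((\<lambda>x. exp (c * (of_real y + \<i> * of_real x)) / (c * \<i>)) has_vector_derivative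
        (c * \<i>) * exp (c * (of_real y + \<i> * of_real x)) / (c * \<i>)) (at x within A)"
      by (rule has_vector_derivative_real_field)
        (auto intro!: derivative_eq_intros)
    then show ?thesis
      using c by (simp add: F_def [abs_def] Complex_eq)
  qed
  have "((\<lambda>x. exp (c * Complex y x)) has_integral (F (1 / 2) - F (- 1 / 2))) {- 1 / 2..1 / 2}"
    by (intro fundamental_theorem_of_calculus F) auto
  moreover have "F (1 / 2) = F (- 1 / 2)"
  proof -
    have "c * Complex y (1 / 2) = c * Complex y (- 1 / 2) + of_int (2 * k) * of_real pi * \<i>"
      by (simp add: c_def Complex_eq algebra_simps)
    moreover have "exp (of_int (2 * k) * of_real pi * \<i>) = (1 :: complex)"
      using exp_integer_2pi[of "of_int k"] by simp
    ultimately show ?thesis by (simp add: F_def exp_add)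
  qed
  ultimately show ?thesis using False by (simp add: c_def)
qed

lemma distinct_partitions_eq:
  assumes "n \<le> N"
  shows "distinct_partitions n = {P \<in> Pow {1..N}. \<Sum>P = n}"
proof -
  have "P \<subseteq> {1..N}" if "finite P" "\<forall>k\<in>P. 0 < k" "\<Sum>P = n" for P
    using that assms member_le_sum[where f = "\<lambda>x. x" and A = P] by (fastforce simp: Suc_le_eq)
  then show ?thesis
    by (auto simp: distinct_partitions_def intro: finite_subset)
qed

text \<open>Parts above n cannot occur in a partition of n, so every truncation with N >= n gives q
  n exactly and orthogonality is applied to a finite sum.\<close>

lemma q_eq_integral_partial_prod:
  assumes "n \<le> N"
  shows "((\<lambda>x. (\<Prod>j=1..N. 1 + exp (- 2 * pi * Complex y x) ^ j) * exp (2 * pi * n * Complex y x))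
    has_integral of_nat (q n)) {- 1 / 2..1 / 2}"
proof -
  have "((\<lambda>x. \<Sum>P\<in>Pow {1..N}. exp (2 * pi * of_int (int n - int (\<Sum>P)) * Complex y x)) has_integral
      (\<Sum>P\<in>Pow {1..N}. if int n - int (\<Sum>P) = 0 then 1 else 0)) {- 1 / 2..1 / 2}"
    by (intro has_integral_sum integral_exp_period) auto
  also have "(\<Sum>P\<in>Pow {1..N}. if int n - int (\<Sum>P) = 0 then 1 else 0)
      = (\<Sum>P\<in>{P \<in> Pow {1..N}. \<Sum>P = n}. 1 :: complex)"
    by (rule sum.mono_neutral_cong_right) (auto simp del: of_nat_sum)
  also have "\<dots> = of_nat (q n)"
    by (simp add: q_def distinct_partitions_eq[OF assms])
  also have "(\<lambda>x. \<Sum>P\<in>Pow {1..N}. exp (2 * pi * of_int (int n - int (\<Sum>P)) * Complex y x))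
      = (\<lambda>x. (\<Prod>j=1..N. 1 + exp (- 2 * pi * Complex y x) ^ j) * exp (2 * pi * n * Complex y x))"
  proof
    fix x
    define z where "z = Complex y x"
    define r where "r = exp (- 2 * pi * z)"
    have "(\<Prod>j=1..N. 1 + r ^ j) = (\<Sum>P\<in>Pow {1..N}. \<Prod>j\<in>P. r ^ j)"
      using prod_add[of "{1..N}" "\<lambda>j. r ^ j" "\<lambda>_. 1"] by (simp add: add.commute)
    also have "\<dots> = (\<Sum>P\<in>Pow {1..N}. r ^ \<Sum>P)"
      by (simp add: power_sum)
    finally have "(\<Prod>j=1..N. 1 + r ^ j) * exp (2 * pi * n * z) = (\<Sum>P\<in>Pow {1..N}. r ^ \<Sum>P * exp (2 * pi * n * z))"
      by (simp add: sum_distrib_right)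
    also have "\<dots> = (\<Sum>P\<in>Pow {1..N}. exp (2 * pi * of_int (int n - int (\<Sum>P)) * z))"
    proof (rule sum.cong)
      fix P :: "nat set"
      have "r ^ \<Sum>P = exp (of_nat (\<Sum>P) * (- 2 * pi * z))"
        unfolding r_def by (rule exp_of_nat_mult [symmetric])
      then show "r ^ \<Sum>P * exp (2 * pi * n * z) = exp (2 * pi * of_int (int n - int (\<Sum>P)) * z)"
        by (simp add: algebra_simps flip: exp_add)
    qed simp
    finally show "(\<Sum>P\<in>Pow {1..N}. exp (2 * pi * of_int (int n - int (\<Sum>P)) * Complex y x))
      = (\<Prod>j=1..N. 1 + exp (- 2 * pi * Complex y x) ^ j) * exp (2 * pi * n * Complex y x)"
      unfolding r_def z_def by (rule sym)
  qed
  finally show ?thesis .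
qed

lemma q_eq_integral_weber2:
  assumes "y > 0"
  shows "((\<lambda>x. weber2 (Complex y x) * exp (2 * pi * (n + 1 / 24) * Complex y x)) has_integral
    (sqrt 2 * q n)) {- 1 / 2..1 / 2}"
proof -
  define r where "r x = exp (- 2 * pi * Complex y x)" for x
  define R where "R = exp (- 2 * pi * y)"
  have R: "0 < R" "R < 1" and nr: "norm (r x) = R" for x
    using assms by (auto simp: r_def R_def)
  \<comment> \<open>Starting at n factors makes every member of the sequence integrate to q n, so
    only the integrand has to converge.\<close>
  define f where "f N x = (\<Prod>j<n + N. 1 + r x * r x ^ j) * exp (2 * pi * n * Complex y x)" for N x
  have shift: "(\<Prod>j=1..m. 1 + r x ^ j) = (\<Prod>j<m. 1 + r x * r x ^ j)" for x m
    by (simp add: prod.atLeast1_atMost_eq)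
  have f: "(f N has_integral of_nat (q n)) {- 1 / 2..1 / 2}" for N
    using q_eq_integral_partial_prod[where n = n and N = "n + N" and y = y, OF le_add1] unfolding r_def [symmetric] shift f_def .
  have "((\<lambda>x. exp (logprod (r x) (r x)) * exp (2 * pi * n * Complex y x)) has_integral of_nat (q n)) {- 1 / 2..1 / 2}"
  proof (rule has_integral_dominated_convergence[OF f, of "\<lambda>_. exp (R / (1 - R)) * exp (2 * pi * n * y)"])
    show "\<forall>x\<in>{- 1 / 2..1 / 2}. norm (f N x) \<le> exp (R / (1 - R)) * exp (2 * pi * n * y)" for N
    proof
      fix x
      have "norm (\<Prod>j<n + N. 1 + r x * r x ^ j) = (\<Prod>j<n + N. norm (1 + r x * r x ^ j))"
        by (rule prod_norm [symmetric])
      also have "\<dots> \<le> (\<Prod>j<n + N. 1 + norm (r x * r x ^ j))"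
        by (intro prod_mono) (auto intro: order_trans[OF norm_triangle_ineq])
      also have "\<dots> \<le> exp (R / (1 - R))"
        using norm_partial_prod_le[of "r x" "r x" "n + N"] R nr by simp
      finally have "norm (\<Prod>j<n + N. 1 + r x * r x ^ j) \<le> exp (R / (1 - R))" .
      then show "norm (f N x) \<le> exp (R / (1 - R)) * exp (2 * pi * n * y)"
        by (simp add: f_def norm_mult)
    qed
    show "\<forall>x\<in>{- 1 / 2..1 / 2}. (\<lambda>N. f N x) \<longlonglongrightarrow> exp (logprod (r x) (r x)) * exp (2 * pi * n * Complex y x)"
    proof
      fix x
      have "(\<lambda>N. \<Prod>j<N. 1 + r x * r x ^ j) \<longlonglongrightarrow> exp (logprod (r x) (r x))"
        using R nr by (intro prod_tendsto_exp_logprod) auto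
      from LIMSEQ_ignore_initial_segment[OF this, of n]
      have "(\<lambda>N. \<Prod>j<n + N. 1 + r x * r x ^ j) \<longlonglongrightarrow> exp (logprod (r x) (r x))"
        by (simp add: add.commute)
      then show "(\<lambda>N. f N x) \<longlonglongrightarrow> exp (logprod (r x) (r x)) * exp (2 * pi * n * Complex y x)"
        unfolding f_def by (intro tendsto_intros)
    qed
  qed (auto intro: integrable_const_ivl)
  from has_integral_mult_right[OF this, of "complex_of_real (sqrt 2)"]
  have "((\<lambda>x. sqrt 2 * (exp (logprod (r x) (r x)) * exp (2 * pi * n * Complex y x))) has_integral
     sqrt 2 * of_nat (q n)) {- 1 / 2..1 / 2}"
    by simp
  \<comment> \<open>The shift 1 / 24 in the exponent compensates the prefactor exp (- pi z / 12) of
    \<open>weber2\<close>.\<close>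
  moreover have "weber2 (Complex y x) * exp (2 * pi * (n + 1 / 24) * Complex y x)
     = sqrt 2 * (exp (logprod (r x) (r x)) * exp (2 * pi * n * Complex y x))" for x
  proof -
    have "exp (- pi * Complex y x / 12) * exp (2 * pi * (n + 1 / 24) * Complex y x) = exp (2 * pi * n * Complex y x)"
      by (simp add: algebra_simps flip: exp_add)
    then show ?thesis by (simp add: weber2_def r_def mult_ac)
  qed
  ultimately show ?thesis by simp
qed

section \<open>The Bessel function as a contour integral\<close>

text \<open>Substituting u = cos t gives the integral of (sin t)^2 exp (s cos t) over each half
  period; integration by parts over the full period trades s (sin t)^2 for cos t.\<close>

lemma bessel_I1_eq_integral_cos:
  assumes s: "s > 0"
  shows "((\<lambda>t. exp (s * cos t) * cos t) has_integral (2 * pi * bessel_I1 s)) {0..2 * pi}"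
proof -
  define g where "g u = (1 - u\<^sup>2) powr (1 / 2) * exp (s * u)" for u :: real
  \<comment> \<open>Differentiating G (cos t) needs \<open>g\<close> only to be continuous, although
    its slope is infinite at the endpoints. The sign of sin t makes the two half periods separate
    cases.\<close>
  define G where "G u = integral {-1..u} g" for u
  have g: "continuous_on {-1..1} g"
  proof -
    have "continuous_on {-1..1} (\<lambda>u. sqrt (1 - u\<^sup>2) * exp (s * u))"
      by (intro continuous_intros)
    moreover have "sqrt (1 - u\<^sup>2) * exp (s * u) = g u" if "u \<in> {-1..1}" for u
    proof -
      have "0 \<le> 1 - u\<^sup>2" using that by (simp add: abs_square_le_1 abs_le_iff)
      then show ?thesis by (simp add: g_def powr_half_sqrt)
    qed
    ultimately show ?thesis by (rule continuous_on_eq)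
  qed
  have gcos: "g (cos t) = \<bar>sin t\<bar> * exp (s * cos t)" for t
    by (simp add: g_def powr_half_sqrt flip: sin_squared_eq)
  have dG: "((\<lambda>t. G (cos t)) has_vector_derivative (- sin t * \<bar>sin t\<bar> * exp (s * cos t))) (at t within A)" for t A
  proof -
    have "(G has_vector_derivative g (cos t)) (at (cos t) within {-1..1})"
      unfolding G_def by (rule integral_has_vector_derivative[OF g]) auto
    then have "(G has_vector_derivative g (cos t)) (at (cos t) within cos ` A)"
      by (rule has_vector_derivative_within_subset) auto
    moreover have "(cos has_vector_derivative - sin t) (at t within A)"
      by (auto intro!: derivative_eq_intros simp flip: has_real_derivative_iff_has_vector_derivative)
    ultimately have "((G \<circ> cos) has_vector_derivative (- sin t *\<^sub>R g (cos t))) (at t within A)"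
      by (rule vector_diff_chain_within[rotated])
    then show ?thesis by (simp add: gcos o_def mult.assoc)
  qed
  have G: "G (-1) = 0" "G 1 = integral {-1..1} g" by (simp_all add: G_def)
  have 1: "((\<lambda>t. (sin t)\<^sup>2 * exp (s * cos t)) has_integral G 1) {0..pi}"
  proof -
    have "((\<lambda>t. - (- sin t * \<bar>sin t\<bar> * exp (s * cos t))) has_integral - (G (cos pi) - G (cos 0))) {0..pi}"
      by (intro has_integral_neg fundamental_theorem_of_calculus dG) simp
    then have "((\<lambda>t. - (- sin t * \<bar>sin t\<bar> * exp (s * cos t))) has_integral G 1) {0..pi}"
      using G by simp
    then show ?thesis
      by (rule has_integral_eq[rotated]) (auto simp: power2_eq_square sin_ge_zero)
  qed
  have 2: "((\<lambda>t. (sin t)\<^sup>2 * exp (s * cos t)) has_integral G 1) {pi..2 * pi}"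
  proof -
    have "((\<lambda>t. - sin t * \<bar>sin t\<bar> * exp (s * cos t)) has_integral (G (cos (2 * pi)) - G (cos pi))) {pi..2 * pi}"
      by (intro fundamental_theorem_of_calculus dG) simp
    then have "((\<lambda>t. - sin t * \<bar>sin t\<bar> * exp (s * cos t)) has_integral G 1) {pi..2 * pi}"
      using G by simp
    then show ?thesis
    proof (rule has_integral_eq[rotated])
      fix t assume "t \<in> {pi..2 * pi}"
      then have "sin t \<le> 0" using sin_ge_zero[of "t - pi"] by simp
      then show "- sin t * \<bar>sin t\<bar> * exp (s * cos t) = (sin t)\<^sup>2 * exp (s * cos t)"
        by (simp add: power2_eq_square)
    qed
  qed
  have 12: "((\<lambda>t. (sin t)\<^sup>2 * exp (s * cos t)) has_integral G 1 + G 1) {0..2 * pi}"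
    by (rule has_integral_combine[OF _ _ 1 2]) auto
  have "((\<lambda>t. exp (s * cos t) * cos t - s * ((sin t)\<^sup>2 * exp (s * cos t))) has_integral
     (exp (s * cos (2 * pi)) * sin (2 * pi) - exp (s * cos 0) * sin 0)) {0..2 * pi}"
    by (rule fundamental_theorem_of_calculus)
      (auto intro!: derivative_eq_intros simp: power2_eq_square algebra_simps
        simp flip: has_real_derivative_iff_has_vector_derivative)
  from has_integral_add[OF this has_integral_mult_right[OF 12, of s]]
  have "((\<lambda>t. exp (s * cos t) * cos t) has_integral s * (G 1 + G 1)) {0..2 * pi}"
    by simp
  also have "s * (G 1 + G 1) = 2 * pi * bessel_I1 s"
    using s unfolding G bessel_I1_def g_def by simp
  finally show ?thesis .
qed

text \<open>On this circle, which passes through the saddle points, a w and b / w are complex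
  conjugates of modulus sqrt (a b), so the exponent is real.\<close>

lemma contour_integral_circle_bessel:
  assumes a: "a > 0" and b: "b > 0"
  shows "contour_integral (circlepath 0 (sqrt (b / a))) (\<lambda>w. exp (of_real a * w + of_real b / w))
    = 2 * pi * \<i> * sqrt (b / a) * bessel_I1 (2 * sqrt (a * b))"
proof -
  define r where "r = sqrt (b / a)"
  define s where "s = 2 * sqrt (a * b)"
  have r: "r > 0" and s: "s > 0" using a b by (simp_all add: r_def s_def)
  have ar: "a * r = s / 2" and br: "b / r = s / 2"
    using a b by (simp_all add: r_def s_def real_sqrt_divide real_sqrt_mult field_simps)
  have e: "of_real a * (of_real r * cis t) + of_real b / (of_real r * cis t) = of_real (s * cos t)" for t
  proof -
    have 1: "of_real a * (of_real r * cis t) = of_real (a * r) * cis t"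
      and 2: "of_real b / (of_real r * cis t) = of_real (b / r) * cis (- t)"
      by (simp_all add: cis_divide [symmetric] field_simps flip: cis_inverse)
    show ?thesis unfolding 1 2 ar br
      by (simp add: complex_eq_iff)
  qed
  have "contour_integral (circlepath 0 r) (\<lambda>w. exp (of_real a * w + of_real b / w))
     = integral {0..2 * pi} (\<lambda>t. exp (of_real a * (0 + r * cis t) + of_real b / (0 + r * cis t)) * r * \<i> * cis t)"
    unfolding circlepath_def by (rule contour_integral_part_circlepath_eq) simp
  also have "\<dots> = integral {0..2 * pi} (\<lambda>t. (r * \<i>) * (of_real (exp (s * cos t) * cos t) + \<i> * of_real (exp (s * cos t) * sin t)))"
    unfolding add_0 e by (simp add: cis_conv_exp exp_Euler cos_of_real sin_of_real algebra_simps flip: exp_of_real)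
  also have "\<dots> = (r * \<i>) * (of_real (2 * pi * bessel_I1 s) + \<i> * of_real 0)"
  proof (intro integral_unique has_integral_mult_right has_integral_add)
    show "((\<lambda>t. complex_of_real (exp (s * cos t) * cos t)) has_integral of_real (2 * pi * bessel_I1 s)) {0..2 * pi}"
      by (intro has_integral_of_real bessel_I1_eq_integral_cos s)
    have "((\<lambda>t. exp (s * cos t) * sin t) has_integral (- exp (s * cos (2 * pi)) / s - (- exp (s * cos 0) / s))) {0..2 * pi}"
      by (rule fundamental_theorem_of_calculus)
        (use s in \<open>auto intro!: derivative_eq_intros simp flip: has_real_derivative_iff_has_vector_derivative\<close>)
    then have "((\<lambda>t. exp (s * cos t) * sin t) has_integral 0) {0..2 * pi}" by simp
    then show "((\<lambda>t. complex_of_real (exp (s * cos t) * sin t)) has_integral of_real 0) {0..2 * pi}"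
      by (rule has_integral_of_real)
  qed
  finally show ?thesis unfolding r_def s_def by simp
qed

text \<open>The residue is never computed: the rectangle and the circle both give 2 pi i times it.
  The error comes from the other three sides, of lengths 2 y, 2 y and 2 t.\<close>

lemma segment_integral_bessel:
  assumes a: "a > 0" and b: "b > 0" and y: "y > 0" and t: "t > 0"
  shows "norm (integral {-t..t} (\<lambda>x. exp (of_real a * Complex y x + of_real b / Complex y x))
      - 2 * pi * sqrt (b / a) * bessel_I1 (2 * sqrt (a * b)))
     \<le> exp (a * y + b * y / t\<^sup>2) * (4 * y + 2 * t)"
proof -
  define f where "f w = exp (of_real a * w + of_real b / w)" for w :: complex
  define K where "K = exp (a * y + b * y / t\<^sup>2)"
  define p1 p2 p3 p4 where p: "p1 = Complex (- y) (- t)" "p2 = Complex y (- t)" "p3 = Complex y t" "p4 = Complex (- y) t"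
  have holo: "f holomorphic_on UNIV - {0}"
    unfolding f_def by (auto intro!: holomorphic_intros)
  have cont: "continuous_on A f" if "0 \<notin> A" for A
    using holo that by (intro holomorphic_on_imp_continuous_on) (auto elim: holomorphic_on_subset)
  have box: "0 \<in> box p1 p3" using y t by (simp add: p in_box_complex_iff)
  have rect: "rectpath p1 p3 = linepath p1 p2 +++ linepath p2 p3 +++ linepath p3 p4 +++ linepath p4 p1"
    by (simp add: rectpath_def Let_def p)
  have seg: "closed_segment p1 p2 = {z. Im z = - t \<and> Re z \<in> {- y..y}}"
      "closed_segment p2 p3 = {z. Re z = y \<and> Im z \<in> {- t..t}}"
      "closed_segment p3 p4 = {z. Im z = t \<and> Re z \<in> {- y..y}}"
      "closed_segment p4 p1 = {z. Re z = - y \<and> Im z \<in> {- t..t}}"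
    using y t by (auto simp: p closed_segment_same_Re closed_segment_same_Im closed_segment_eq_real_ivl)
  have img: "0 \<notin> path_image (rectpath p1 p3)"
    using y t by (simp add: path_image_rectpath p)
  have int: "f contour_integrable_on linepath p1 p2" "f contour_integrable_on linepath p2 p3"
      "f contour_integrable_on linepath p3 p4" "f contour_integrable_on linepath p4 p1"
    using y t by (auto intro!: contour_integrable_continuous_linepath cont simp: seg)
  have circ: "contour_integral (circlepath 0 r) f = 2 * pi * \<i> * residue f 0" if "r > 0" for r
  proof -
    have "contour_integral (circlepath 0 r) f = 2 * pi * \<i> * (\<Sum>p\<in>{0}. winding_number (circlepath 0 r) p * residue f p)"
      by (rule Residue_theorem[of UNIV]) (use holo that in auto)
    then show ?thesis using that by (simp add: winding_number_circlepath)
  qed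
  have "contour_integral (rectpath p1 p3) f = 2 * pi * \<i> * (\<Sum>p\<in>{0}. winding_number (rectpath p1 p3) p * residue f p)"
    by (rule Residue_theorem[of UNIV]) (use holo img in auto)
  also have "\<dots> = contour_integral (circlepath 0 (sqrt (b / a))) f"
    using a b box by (subst circ) (simp_all add: winding_number_rectpath)
  also have "\<dots> = 2 * pi * \<i> * sqrt (b / a) * bessel_I1 (2 * sqrt (a * b))"
    unfolding f_def by (rule contour_integral_circle_bessel[OF a b])
  finally have total: "contour_integral (rectpath p1 p3) f = 2 * pi * \<i> * sqrt (b / a) * bessel_I1 (2 * sqrt (a * b))" .
  have split: "contour_integral (rectpath p1 p3) f = contour_integral (linepath p1 p2) f + (contour_integral (linepath p2 p3) f
     + (contour_integral (linepath p3 p4) f + contour_integral (linepath p4 p1) f))"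
    unfolding rect using int by (simp add: contour_integrable_join)
  have right: "contour_integral (linepath p2 p3) f = \<i> * integral {-t..t} (\<lambda>x. f (Complex y x))"
    using t by (intro contour_integral_linepath_same_Re) (auto simp: p)
  have nf: "norm (f w) = exp (a * Re w + b * Re w / (norm w)\<^sup>2)" for w
  proof -
    have "Re (of_real b / w) = b * Re w / (norm w)\<^sup>2"
      by (simp add: Re_divide cmod_power2)
    then show ?thesis by (simp add: f_def)
  qed
  have K1: "1 \<le> K" using a b y by (simp add: K_def)
  have left_le: "norm (f w) \<le> K" if "Re w \<le> 0" for w
  proof -
    have "a * Re w + b * Re w / (norm w)\<^sup>2 \<le> 0"
      using that a b by (auto intro!: add_nonpos_nonpos mult_nonneg_nonpos divide_nonpos_nonneg)
    then have "norm (f w) \<le> 1" unfolding nf by simp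
    then show ?thesis using K1 by linarith
  qed
  \<comment> \<open>On a horizontal side norm w >= t, so for Re w > 0 the term b Re w / (norm w)^2
    is at most b y / t^2.\<close>
  have hor_le: "norm (f w) \<le> K" if "\<bar>Im w\<bar> = t" "Re w \<le> y" for w
  proof (cases "Re w \<le> 0")
    case False
    have "t\<^sup>2 = (Im w)\<^sup>2" using that(1) by (metis power2_abs)
    then have "t\<^sup>2 \<le> (norm w)\<^sup>2" by (simp add: cmod_power2)
    then have "b * Re w / (norm w)\<^sup>2 \<le> b * y / t\<^sup>2"
      using False that b t by (intro frac_le mult_left_mono) auto
    moreover have "a * Re w \<le> a * y" using that a by simp
    ultimately show ?thesis unfolding nf K_def by simp
  qed (rule left_le)
  have b1: "norm (contour_integral (linepath p1 p2) f) \<le> K * norm (p2 - p1)"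
    by (rule contour_integral_bound_linepath) (use int K1 t in \<open>auto simp: seg intro!: hor_le\<close>)
  have b3: "norm (contour_integral (linepath p3 p4) f) \<le> K * norm (p4 - p3)"
    by (rule contour_integral_bound_linepath) (use int K1 t in \<open>auto simp: seg intro!: hor_le\<close>)
  have b4: "norm (contour_integral (linepath p4 p1) f) \<le> K * norm (p1 - p4)"
    by (rule contour_integral_bound_linepath) (use int K1 y in \<open>auto simp: seg intro!: left_le\<close>)
  have len: "norm (p2 - p1) = 2 * y" "norm (p4 - p3) = 2 * y" "norm (p1 - p4) = 2 * t"
    using y t by (simp_all add: p cmod_def real_sqrt_mult)
  define J where "J = integral {-t..t} (\<lambda>x. f (Complex y x)) - 2 * pi * sqrt (b / a) * bessel_I1 (2 * sqrt (a * b))"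
  have "\<i> * J = - (contour_integral (linepath p1 p2) f + contour_integral (linepath p3 p4) f + contour_integral (linepath p4 p1) f)"
    using total split unfolding right J_def by (simp add: algebra_simps add_eq_0_iff)
  then have "norm J = norm (contour_integral (linepath p1 p2) f + contour_integral (linepath p3 p4) f + contour_integral (linepath p4 p1) f)"
    by (metis norm_minus_cancel norm_mult norm_ii mult_1)
  also have "\<dots> \<le> K * (2 * y) + K * (2 * y) + K * (2 * t)"
    using b1 b3 b4 unfolding len by (intro order_trans[OF norm_triangle_ineq] add_mono) auto
  also have "\<dots> = K * (4 * y + 2 * t)" by (simp add: algebra_simps)
  finally show ?thesis unfolding J_def K_def f_def .
qed

section \<open>The minor arcs\<close>

lemma arctan_bounds:
  assumes "x \<ge> (0 :: real)"
  shows "arctan x \<le> x - x ^ 3 / 3 + x ^ 5 / 5" "x - x ^ 3 / 3 \<le> arctan x"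
proof -
  have "(\<lambda>x. x - x ^ 3 / 3 + x ^ 5 / 5 - arctan x) 0 \<le> (\<lambda>x. x - x ^ 3 / 3 + x ^ 5 / 5 - arctan x) x"
  proof (rule DERIV_nonneg_imp_nondecreasing[OF assms])
    fix t :: real
    have p: "1 + t\<^sup>2 > 0" by (smt (verit) zero_le_power2)
    have "((\<lambda>x. x - x ^ 3 / 3 + x ^ 5 / 5 - arctan x) has_real_derivative (1 - t\<^sup>2 + t ^ 4 - inverse (1 + t\<^sup>2))) (at t)"
      by (auto intro!: derivative_eq_intros simp: eval_nat_numeral)
    moreover have "1 - t\<^sup>2 + t ^ 4 - inverse (1 + t\<^sup>2) = (t ^ 3)\<^sup>2 / (1 + t\<^sup>2)"
      using p by (simp add: field_simps)
    ultimately show "\<exists>y. ((\<lambda>x. x - x ^ 3 / 3 + x ^ 5 / 5 - arctan x) has_real_derivative y) (at t) \<and> 0 \<le> y"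
      using p by (intro exI[of _ "(t ^ 3)\<^sup>2 / (1 + t\<^sup>2)"]) auto
  qed
  then show "arctan x \<le> x - x ^ 3 / 3 + x ^ 5 / 5" by simp
  have "(\<lambda>x. arctan x - (x - x ^ 3 / 3)) 0 \<le> (\<lambda>x. arctan x - (x - x ^ 3 / 3)) x"
  proof (rule DERIV_nonneg_imp_nondecreasing[OF assms])
    fix t :: real
    have p: "1 + t\<^sup>2 > 0" by (smt (verit) zero_le_power2)
    have "((\<lambda>x. arctan x - (x - x ^ 3 / 3)) has_real_derivative (inverse (1 + t\<^sup>2) - (1 - t\<^sup>2))) (at t)"
      by (auto intro!: derivative_eq_intros simp: eval_nat_numeral)
    moreover have "inverse (1 + t\<^sup>2) - (1 - t\<^sup>2) = (t\<^sup>2)\<^sup>2 / (1 + t\<^sup>2)"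
      using p by (simp add: field_simps)
    ultimately show "\<exists>y. ((\<lambda>x. arctan x - (x - x ^ 3 / 3)) has_real_derivative y) (at t) \<and> 0 \<le> y"
      using p by (intro exI[of _ "(t\<^sup>2)\<^sup>2 / (1 + t\<^sup>2)"]) auto
  qed
  then show "x - x ^ 3 / 3 \<le> arctan x" by simp
qed

text \<open>The upper bound has to separate 134 from 135: the square of nu at 134 is about 440.98,
  against 21^2 = 441, and 3.1417 would already be too large.\<close>

lemma pi_bounds: "pi < 314166 / 100000" "pi > 3141 / 1000"
  using machin_Euler arctan_bounds[of "1 / 7"] arctan_bounds[of "3 / 79"]
  by (simp_all add: eval_nat_numeral)

lemma nu_squared: "(\<nu> n)\<^sup>2 = pi\<^sup>2 * (real n + 1 / 24) / 3"
  by (simp add: \<nu>_def power_divide power_mult_distrib field_simps)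

lemma nu_pos: "\<nu> n > 0"
  by (simp add: \<nu>_def)

lemma nu_ge_21_iff: "\<nu> n \<ge> 21 \<longleftrightarrow> n \<ge> 135"
proof -
  have "21 \<le> \<nu> n \<longleftrightarrow> 21\<^sup>2 \<le> (\<nu> n)\<^sup>2"
    using nu_pos[of n] by (metis abs_of_pos power2_le_iff_abs_le zero_less_numeral less_imp_le abs_le_square_iff abs_numeral)
  also have "\<dots> \<longleftrightarrow> n \<ge> 135"
  proof
    assume "n \<ge> 135"
    have "(3141 / 1000)\<^sup>2 * (135 + 1 / 24) \<le> pi\<^sup>2 * (real n + 1 / 24)"
      using pi_bounds \<open>n \<ge> 135\<close> by (intro mult_mono power_mono) auto
    then show "21\<^sup>2 \<le> (\<nu> n)\<^sup>2" unfolding nu_squared by (simp add: power2_eq_square)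
  next
    assume *: "21\<^sup>2 \<le> (\<nu> n)\<^sup>2"
    show "n \<ge> 135"
    proof (rule ccontr)
      assume "\<not> n \<ge> 135"
      then have "pi\<^sup>2 * (real n + 1 / 24) \<le> (314166 / 100000)\<^sup>2 * (134 + 1 / 24)"
        using pi_bounds by (intro mult_mono power_mono) auto
      with * show False unfolding nu_squared by (simp add: power2_eq_square)
    qed
  qed
  finally show ?thesis .
qed

text \<open>Its square root turns the saving exp (- 7 v / 96) into 1 / sqrt v. At 21 the right side
  is exp (49 / 16), about 21.4; beyond, exp x >= 1 + x suffices because 21 * 7 / 48 > 1.\<close>

lemma le_exp_growth:
  fixes v :: real
  assumes "v \<ge> 21"
  shows "v \<le> exp (7 * v / 48)"
proof -
  \<comment> \<open>A twentieth of 49 / 16 is small enough for the quadratic Taylor bound.\<close>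
  have "1 + 49 / 320 + (49 / 320)\<^sup>2 / 2 \<le> exp (49 / 320 :: real)"
    by (rule exp_lower_Taylor_quadratic) simp
  then have "11648 / 10000 \<le> exp (49 / 320 :: real)" by (simp add: power2_eq_square)
  then have "(11648 / 10000) ^ 20 \<le> exp (49 / 320 :: real) ^ 20"
    by (intro power_mono) auto
  also have "\<dots> = exp (49 / 16)" by (simp flip: exp_of_nat_mult)
  finally have e: "21 \<le> exp (49 / 16 :: real)" by (simp add: eval_nat_numeral)
  have "v \<le> 21 * (1 + 7 * (v - 21) / 48)" using assms by (simp add: field_simps)
  also have "\<dots> \<le> exp (49 / 16) * exp (7 * (v - 21) / 48)"
    using e assms exp_ge_add_one_self[of "7 * (v - 21) / 48"] by (intro mult_mono) auto
  also have "\<dots> = exp (7 * v / 48)" by (simp add: algebra_simps diff_divide_distrib flip: exp_add)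
  finally show ?thesis .
qed

section \<open>Size of \<open>weber2\<close> off the main segment\<close>

lemma Re_inverse_Complex: "Re (1 / Complex y x) = y / (y\<^sup>2 + x\<^sup>2)"
  by (simp add: Re_divide)

lemma cusp_height_Complex: "cusp_height (Complex y x) c d = y / ((of_int d - of_int c * x)\<^sup>2 + (of_int c * y)\<^sup>2)"
proof -
  have "of_int d + \<i> * of_int c * Complex y x = Complex (of_int d - of_int c * x) (of_int c * y)"
    by (simp add: complex_eq_iff)
  then show ?thesis by (simp add: cusp_height_def cmod_power2)
qed

text \<open>From h <= 1 / (c^2 y) follows pi h / 24 <= 3 v / (2 c^2): v / 6 for |c| = 3 and at most
  3 v / 32 for |c| >= 4. For |c| = 1, |x| >= sqrt y gives h <= 1. For |c| = 3, distance y from 1/3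
  and - 1/3 raises the denominator from 9 y^2 to 18 y^2, above the 16 y^2 used for |c| >= 4.\<close>

lemma norm_weber2_minor:
  fixes v :: real
  assumes v: "v \<ge> 21" and y: "y = pi / (36 * v)" and t: "t = sqrt y" and x: "t \<le> \<bar>x\<bar>" "\<bar>x\<bar> \<le> 1 / 2"
  shows "norm (weber2 (Complex y x)) \<le> 13 / 10 * exp (v / 6)"
    and "\<bar>\<bar>x\<bar> - 1 / 3\<bar> \<ge> y \<Longrightarrow> norm (weber2 (Complex y x)) \<le> 13 / 10 * exp (3 * v / 32)"
proof -
  have y0: "y > 0" using v by (simp add: y)
  have "36 * 21 \<le> 36 * v" using v by simp
  then have "y \<le> 4 / (36 * 21)"
    unfolding y using pi_less_4 by (intro frac_le) auto
  then have y1: "y \<le> 1 / 180" by simp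
  have t2: "t\<^sup>2 = y" "t > 0" using y0 by (simp_all add: t)
  have py: "pi / 24 / y = 3 * v / 2" using v by (simp add: y)
  obtain c d where cd: "coprime c d" and H: "cusp_height (Complex y x) c d \<ge> 1 / 2"
    "norm (weber2 (Complex y x)) \<le> cusp_bound (even c) (cusp_height (Complex y x) c d)"
    using cusp_bounded[of "Complex y x"] y0 unfolding cusp_bounded_def by auto
  define h where "h = cusp_height (Complex y x) c d"
  have h: "h = y / ((of_int d - of_int c * x)\<^sup>2 + (of_int c * y)\<^sup>2)"
    unfolding h_def by (rule cusp_height_Complex)
  have v6: "3 * v / 32 \<le> v / 6" using v by simp
  have goal_if: "norm (weber2 (Complex y x)) \<le> 13 / 10 * exp e" if "odd c" "pi * h / 24 \<le> e" for e
    using H(2) that unfolding h_def [symmetric] cusp_bound_def by (simp add: order_trans[OF _ mult_left_mono])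
  have small: "pi * h / 24 \<le> 3 * v / 32" if "h \<le> 1 / (16 * y)"
  proof -
    have "pi * h / 24 \<le> pi * (1 / (16 * y)) / 24" using that by (intro divide_right_mono mult_left_mono) auto
    also have "\<dots> = (pi / 24 / y) / 16" by simp
    also have "\<dots> = 3 * v / 32" unfolding py by simp
    finally show ?thesis .
  qed
  have small1: "pi * h / 24 \<le> 3 * v / 32" if "h \<le> 1"
  proof -
    have "pi * h / 24 \<le> 4 * 1 / 24" using that H(1) pi_less_4 unfolding h_def by (intro divide_right_mono mult_mono) auto
    then show ?thesis using v by simp
  qed
  have hle: "h \<le> y / D" if "D > 0" "D \<le> (of_int d - of_int c * x)\<^sup>2 + (of_int c * y)\<^sup>2" for D
    unfolding h using that y0 by (intro divide_left_mono mult_pos_pos) auto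
  have main: "(\<bar>\<bar>x\<bar> - 1 / 3\<bar> \<ge> y \<longrightarrow> norm (weber2 (Complex y x)) \<le> 13 / 10 * exp (3 * v / 32)) \<and>
     norm (weber2 (Complex y x)) \<le> 13 / 10 * exp (v / 6)"
  proof -
    have up: ?thesis if "norm (weber2 (Complex y x)) \<le> 13 / 10 * exp (3 * v / 32)"
    proof -
      have "13 / 10 * exp (3 * v / 32) \<le> 13 / 10 * exp (v / 6)" using v6 by simp
      from order_trans[OF that this] show ?thesis using that by blast
    qed
    have "even c \<or> \<bar>c\<bar> = 1 \<or> \<bar>c\<bar> = 3 \<or> odd c \<and> \<bar>c\<bar> \<ge> 4" by presburger
    then consider "even c" | "\<bar>c\<bar> = 1" | "\<bar>c\<bar> = 3" | "odd c" "\<bar>c\<bar> \<ge> 4" by blast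
    then show ?thesis
    proof cases
      case 1
      have "1 + 3 * v / 32 \<le> exp (3 * v / 32)" by (rule exp_ge_add_one_self)
      then have "13 / 10 * exp (3 * v / 32) \<ge> 3 / 2" using v by linarith
      then show ?thesis using 1 H(2) by (intro up) (simp add: cusp_bound_def)
    next
      case 2
      have "\<bar>x\<bar> \<le> \<bar>of_int d - of_int c * x\<bar>"
      proof (cases "d = 0")
        case True
        have "\<bar>real_of_int c\<bar> = 1" using 2 by linarith
        then show ?thesis using True by (simp add: abs_mult)
      next
        case False
        then have "1 \<le> \<bar>real_of_int d\<bar>" by linarith
        moreover have "\<bar>of_int c * x\<bar> = \<bar>x\<bar>" using 2 by (auto simp: abs_mult simp flip: of_int_abs)
        ultimately show ?thesis using x(2) by linarith
      qed
      then have "t\<^sup>2 \<le> (of_int d - of_int c * x)\<^sup>2"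
        using x t2 by (metis abs_le_square_iff abs_of_pos order_trans)
      then have "y \<le> (of_int d - of_int c * x)\<^sup>2 + (of_int c * y)\<^sup>2" using t2 by (simp add: add_increasing2)
      then have "h \<le> y / y" using y0 by (intro hle) auto
      moreover have "odd c" using 2 by presburger
      ultimately show ?thesis using y0 by (intro up goal_if small1) auto
    next
      case 4
      have "4\<^sup>2 * y\<^sup>2 \<le> (real_of_int \<bar>c\<bar>)\<^sup>2 * y\<^sup>2"
      proof (intro mult_right_mono power_mono)
        show "4 \<le> real_of_int \<bar>c\<bar>" using 4 by linarith
      qed auto
      then have "16 * y\<^sup>2 \<le> (of_int d - of_int c * x)\<^sup>2 + (of_int c * y)\<^sup>2"
        by (simp add: power_mult_distrib add_increasing)
      then have "h \<le> y / (16 * y\<^sup>2)" using y0 by (intro hle) auto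
      also have "\<dots> = 1 / (16 * y)" using y0 by (simp add: power2_eq_square)
      finally show ?thesis using 4 by (intro up goal_if small) auto
    next
      case 3
      have c9: "(of_int c * y)\<^sup>2 = 9 * y\<^sup>2"
      proof -
        have "(real_of_int c)\<^sup>2 = (real_of_int \<bar>c\<bar>)\<^sup>2" by simp
        also have "\<dots> = 9" unfolding 3 by simp
        finally show ?thesis by (simp add: power_mult_distrib)
      qed
      have oc: "odd c" using 3 by presburger
      have "9 * y\<^sup>2 \<le> (of_int d - of_int c * x)\<^sup>2 + (of_int c * y)\<^sup>2" unfolding c9 by simp
      then have "h \<le> y / (9 * y\<^sup>2)" using y0 by (intro hle) auto
      also have "\<dots> = 1 / (9 * y)" using y0 by (simp add: power2_eq_square)
      finally have "pi * h / 24 \<le> pi * (1 / (9 * y)) / 24" by (intro divide_right_mono mult_left_mono) auto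
      also have "\<dots> = (pi / 24 / y) / 9" by simp
      also have "\<dots> = v / 6" unfolding py by simp
      finally have A: "norm (weber2 (Complex y x)) \<le> 13 / 10 * exp (v / 6)" using oc by (intro goal_if)
      moreover have "norm (weber2 (Complex y x)) \<le> 13 / 10 * exp (3 * v / 32)" if far: "\<bar>\<bar>x\<bar> - 1 / 3\<bar> \<ge> y"
      proof -
        have cx: "\<bar>of_int c * x\<bar> = 3 * \<bar>x\<bar>" using 3 by (auto simp: abs_mult simp flip: of_int_abs)
        \<comment> \<open>Coprimality excludes d = 0; |d| = 1 belongs to the points 1/3 and - 1/3;
          |d| >= 2 leaves a distance of at least 1/2, since 3 |x| <= 3/2.\<close>
        have "d \<noteq> 0" using cd 3 by auto
        then have "\<bar>d\<bar> = 1 \<or> \<bar>d\<bar> \<ge> 2" by presburger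
        then have "3 * y \<le> \<bar>of_int d - of_int c * x\<bar>"
        proof
          assume "\<bar>d\<bar> = 1"
          then have "\<bar>real_of_int d\<bar> = 1" by linarith
          then show ?thesis using cx far abs_triangle_ineq3[of "of_int d" "of_int c * x"] by linarith
        next
          assume "\<bar>d\<bar> \<ge> 2"
          then have "\<bar>real_of_int d\<bar> \<ge> 2" by linarith
          then show ?thesis using cx x(2) y1 abs_triangle_ineq2[of "of_int d" "of_int c * x"] by linarith
        qed
        moreover have y9: "(3 * y)\<^sup>2 = 9 * y\<^sup>2" by (simp add: power_mult_distrib)
        ultimately have "(3 * y)\<^sup>2 \<le> (of_int d - of_int c * x)\<^sup>2"
          using y0 by (intro abs_le_square_iff[THEN iffD1]) auto
        then have "16 * y\<^sup>2 \<le> (of_int d - of_int c * x)\<^sup>2 + (of_int c * y)\<^sup>2"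
          using c9 y9 zero_le_power2[of y] by linarith
        then have "h \<le> y / (16 * y\<^sup>2)" using y0 by (intro hle) auto
        also have "\<dots> = 1 / (16 * y)" using y0 by (simp add: power2_eq_square)
        finally show ?thesis using oc by (intro goal_if small)
      qed
      ultimately show ?thesis by blast
    qed
  qed
  then show "norm (weber2 (Complex y x)) \<le> 13 / 10 * exp (v / 6)"
    and "\<bar>\<bar>x\<bar> - 1 / 3\<bar> \<ge> y \<Longrightarrow> norm (weber2 (Complex y x)) \<le> 13 / 10 * exp (3 * v / 32)"
    by auto
qed

section \<open>The error estimate\<close>

lemma norm_integral_le:
  fixes f :: "real \<Rightarrow> complex"
  assumes "f integrable_on {a..b}" "a \<le> b" "B \<ge> 0" "\<And>x. x \<in> {a..b} \<Longrightarrow> norm (f x) \<le> B"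
  shows "norm (integral {a..b} f) \<le> B * (b - a)"
  using has_integral_bound_real[of B "{}" f "integral {a..b} f" a b] assms
  by (auto simp: integrable_integral)

text \<open>The three terms stem from the main segment with its rectangle, from the rest of the line
  away from 1/3 and - 1/3, and from the arcs around these two, of total length 4 y = pi / (9 nu).
  The outer factor is the constant modulus of exp (a z) on the line, and sqrt 2 is that of
  \<open>weber2\<close>.\<close>

lemma q_circle_method_bound:
  fixes n :: nat
  assumes v21: "\<nu> n \<ge> 21"
  shows "\<bar>sqrt 2 * q n - pi\<^sup>2 / (6 * \<nu> n) * bessel_I1 (\<nu> n)\<bar>
     \<le> exp (\<nu> n / 6) * (6 / 10 + 13 / 10 * exp (3 * \<nu> n / 32) + 13 * pi / (90 * \<nu> n) * exp (\<nu> n / 6))"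
proof -
  define v where "v = \<nu> n"
  define y where "y = pi / (36 * v)"
  define t where "t = sqrt y"
  define a where "a = 2 * pi * (n + 1 / 24)"
  define b where "b = pi / 24"
  define E where "E = exp (v / 6)"
  have v: "v \<ge> 21" using v21 by (simp add: v_def)
  have E: "E \<ge> 0" "E > 0" by (simp_all add: E_def)
  have y0: "y > 0" using v by (simp add: y_def)
  have "36 * 21 \<le> 36 * v" using v by simp
  then have "y \<le> 4 / (36 * 21)"
    unfolding y_def using pi_less_4 by (intro frac_le) auto
  then have y1: "y \<le> 1 / 180" by simp
  have t2: "t\<^sup>2 = y" "t > 0" using y0 by (simp_all add: t_def)
  have t1: "t \<le> 3 / 40"
    unfolding t_def using y1 by (intro real_le_lsqrt) (auto simp: power2_eq_square)
  have N: "n + 1 / 24 = 3 * v\<^sup>2 / pi\<^sup>2" unfolding v_def nu_squared by simp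
  have a0: "a > 0" and b0: "b > 0" by (auto simp: a_def b_def intro!: mult_pos_pos)
  have ay: "a * y = v / 6"
    unfolding a_def N y_def using v by (simp add: power2_eq_square)
  have ab: "2 * sqrt (a * b) = v"
  proof -
    have "a * b = (v / 2)\<^sup>2"
      unfolding a_def b_def N by (simp add: power2_eq_square)
    then show ?thesis using v by simp
  qed
  have ba: "sqrt (b / a) = pi / (12 * v)"
  proof -
    have "b / a = (pi / (12 * v))\<^sup>2"
      unfolding a_def b_def N using v by (simp add: power2_eq_square)
    then show ?thesis using v by (simp add: real_sqrt_divide)
  qed
  define I where "I x = weber2 (Complex y x) * exp (a * Complex y x)" for x
  define J where "J l u = integral {l..u} I" for l u
  define M where "M x = exp (of_real a * Complex y x + of_real b / Complex y x)" for x
  have I: "(I has_integral (sqrt 2 * q n)) {- 1 / 2..1 / 2}"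
    unfolding I_def a_def by (rule q_eq_integral_weber2[OF y0])
  have int: "I integrable_on {l..u}" if "- 1 / 2 \<le> l" "u \<le> 1 / 2" for l u
    by (rule integrable_on_subinterval[of _ "{- 1 / 2..1 / 2}"]) (use I that in auto)
  have total: "J (- 1 / 2) (1 / 2) = sqrt 2 * q n"
    unfolding J_def using I by (rule integral_unique)
  have comb: "J l u = J l m + J m u" if "- 1 / 2 \<le> l" "l \<le> m" "m \<le> u" "u \<le> 1 / 2" for l m u
    unfolding J_def using that by (intro Henstock_Kurzweil_Integration.integral_combine [symmetric] int)
  have split: "J (- 1 / 2) (1 / 2) = J (- t) t + ((J (- 1 / 2) (- 1 / 3 - y) + J (- 1 / 3 + y) (- t) + J t (1 / 3 - y) + J (1 / 3 + y) (1 / 2))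
     + (J (- 1 / 3 - y) (- 1 / 3 + y) + J (1 / 3 - y) (1 / 3 + y)))"
    using t1 t2 y0 y1 comb[of "- 1 / 2" "- t" "1 / 2"] comb[of "- t" t "1 / 2"]
      comb[of "- 1 / 2" "- 1 / 3 - y" "- t"] comb[of "- 1 / 3 - y" "- 1 / 3 + y" "- t"]
      comb[of t "1 / 3 - y" "1 / 2"] comb[of "1 / 3 - y" "1 / 3 + y" "1 / 2"] by simp
  have nI: "norm (I x) = norm (weber2 (Complex y x)) * E" for x
    by (simp add: I_def norm_mult ay E_def)
  have near: "norm (J l u) \<le> 13 / 10 * E * E * (u - l)"
    if "- 1 / 2 \<le> l" "l \<le> u" "u \<le> 1 / 2" "\<And>x. x \<in> {l..u} \<Longrightarrow> t \<le> \<bar>x\<bar>" for l u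
    unfolding J_def
  proof (rule norm_integral_le)
    show "norm (I x) \<le> 13 / 10 * E * E" if "x \<in> {l..u}" for x
      unfolding nI using E that \<open>- 1 / 2 \<le> l\<close> \<open>u \<le> 1 / 2\<close>
      by (intro mult_right_mono norm_weber2_minor(1)[OF v y_def t_def, folded E_def] \<open>x \<in> {l..u} \<Longrightarrow> t \<le> \<bar>x\<bar>\<close>) auto
  qed (use E that int in auto)
  have far: "norm (J l u) \<le> 13 / 10 * exp (3 * v / 32) * E * (u - l)"
    if "- 1 / 2 \<le> l" "l \<le> u" "u \<le> 1 / 2" "\<And>x. x \<in> {l..u} \<Longrightarrow> t \<le> \<bar>x\<bar> \<and> y \<le> \<bar>\<bar>x\<bar> - 1 / 3\<bar>" for l u
    unfolding J_def
  proof (rule norm_integral_le)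
    fix x assume "x \<in> {l..u}"
    then show "norm (I x) \<le> 13 / 10 * exp (3 * v / 32) * E"
      unfolding nI using E that
      by (intro mult_right_mono norm_weber2_minor(2)[OF v y_def t_def]) auto
  qed (use E that int in auto)
  have near_sum: "norm (J (- 1 / 3 - y) (- 1 / 3 + y) + J (1 / 3 - y) (1 / 3 + y)) \<le> 13 / 10 * E * E * (4 * y)"
  proof -
    have "norm (J (- 1 / 3 - y) (- 1 / 3 + y)) \<le> 13 / 10 * E * E * ((- 1 / 3 + y) - (- 1 / 3 - y))"
      "norm (J (1 / 3 - y) (1 / 3 + y)) \<le> 13 / 10 * E * E * ((1 / 3 + y) - (1 / 3 - y))"
      using y0 y1 t1 t2 by (intro near; auto)+
    then show ?thesis by (intro order_trans[OF norm_triangle_ineq]) (simp add: algebra_simps)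
  qed
  have far_sum: "norm (J (- 1 / 2) (- 1 / 3 - y) + J (- 1 / 3 + y) (- t) + J t (1 / 3 - y) + J (1 / 3 + y) (1 / 2))
      \<le> 13 / 10 * exp (3 * v / 32) * E"
  proof -
    have "norm (J (- 1 / 2) (- 1 / 3 - y)) \<le> 13 / 10 * exp (3 * v / 32) * E * ((- 1 / 3 - y) - (- 1 / 2))"
      "norm (J (- 1 / 3 + y) (- t)) \<le> 13 / 10 * exp (3 * v / 32) * E * ((- t) - (- 1 / 3 + y))"
      "norm (J t (1 / 3 - y)) \<le> 13 / 10 * exp (3 * v / 32) * E * ((1 / 3 - y) - t)"
      "norm (J (1 / 3 + y) (1 / 2)) \<le> 13 / 10 * exp (3 * v / 32) * E * (1 / 2 - (1 / 3 + y))"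
      using y0 y1 t1 t2 by (intro far; auto simp: abs_if)+
    then have "norm (J (- 1 / 2) (- 1 / 3 - y) + J (- 1 / 3 + y) (- t) + J t (1 / 3 - y) + J (1 / 3 + y) (1 / 2))
       \<le> 13 / 10 * exp (3 * v / 32) * E * ((- 1 / 3 - y) - (- 1 / 2)) + 13 / 10 * exp (3 * v / 32) * E * ((- t) - (- 1 / 3 + y))
       + 13 / 10 * exp (3 * v / 32) * E * ((1 / 3 - y) - t) + 13 / 10 * exp (3 * v / 32) * E * (1 / 2 - (1 / 3 + y))"
      by (intro order_trans[OF norm_triangle_ineq] add_mono)
    also have "\<dots> = 13 / 10 * exp (3 * v / 32) * E * (1 - 4 * y - 2 * t)"
      by (simp add: algebra_simps)
    also have "\<dots> \<le> 13 / 10 * exp (3 * v / 32) * E * 1"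
      using y0 t2 E by (intro mult_left_mono) auto
    finally show ?thesis by simp
  qed
  have Mint: "M integrable_on {- t..t}"
  proof -
    have "Complex y x \<noteq> 0" for x using y0 by (simp add: complex_eq_iff)
    then have "continuous_on {- t..t} M"
      unfolding M_def by (auto intro!: continuous_intros continuous_on_Complex)
    then show ?thesis by (rule integrable_continuous_real)
  qed
  have major: "norm (J (- t) t - integral {- t..t} M) \<le> 2 * E * (2 * t)"
  proof -
    have "norm (integral {- t..t} (\<lambda>x. I x - M x)) \<le> 2 * E * (t - (- t))"
    proof (rule norm_integral_le)
      show "(\<lambda>x. I x - M x) integrable_on {- t..t}"
        using t1 by (intro integrable_diff int Mint) auto
      fix x assume x: "x \<in> {- t..t}"
      define z where "z = Complex y x"
      have z: "Re z > 0" "z \<noteq> 0" using y0 by (auto simp: z_def complex_eq_iff)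
      have "x\<^sup>2 \<le> t\<^sup>2" using x by (intro abs_le_square_iff[THEN iffD1]) auto
      then have "y\<^sup>2 + x\<^sup>2 \<le> y * (y + 1)" unfolding t2 by (simp add: power2_eq_square algebra_simps)
      also have "\<dots> \<le> y * 2" using y0 y1 by (intro mult_left_mono) auto
      finally have "y\<^sup>2 + x\<^sup>2 \<le> y * 2" .
      moreover have "y\<^sup>2 + x\<^sup>2 > 0" using y0 by (simp add: add_pos_nonneg)
      ultimately have "1 / 2 \<le> y / (y\<^sup>2 + x\<^sup>2)" by (simp add: pos_le_divide_eq)
      \<comment> \<open>Since t^2 = y, y^2 + x^2 <= y^2 + y <= 2 y, which places 1 / z where
        \<open>weber1_approx\<close> applies.\<close>
      then have Re: "Re (1 / z) \<ge> 1 / 2" unfolding z_def Re_inverse_Complex .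
      have "weber2 z = weber1 (1 / z)"
        using weber1_eq_weber2_inverse[of "1 / z"] Re by simp
      then have "I x - M x = exp (a * z) * (weber1 (1 / z) - exp (pi * (1 / z) / 24))"
        by (simp add: I_def M_def z_def [symmetric] exp_add b_def algebra_simps)
      also have "norm \<dots> \<le> E * 2"
        unfolding norm_mult using weber1_approx[OF Re] E
        by (intro mult_mono) (auto simp: z_def ay E_def)
      finally show "norm (I x - M x) \<le> 2 * E" by simp
    qed (use t2 E in auto)
    then show ?thesis
      using t1 by (simp add: J_def integral_diff int Mint)
  qed
  have bess: "norm (integral {- t..t} M - 2 * pi * (pi / (12 * v)) * bessel_I1 v) \<le> E * (6 / 5) * (4 * y + 2 * t)"
  proof -
    have "pi / 24 \<le> 1 / 6" using pi_less_4 by simp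
    then have "exp (pi / 24) \<le> exp (1 / 6)" by simp
    also have "\<dots> \<le> 1 + 1 / 6 + (1 / 6)\<^sup>2" by (rule exp_bound) auto
    finally have "exp b \<le> 6 / 5" by (simp add: b_def power2_eq_square)
    \<comment> \<open>The choice t^2 = y cancels y, so the rectangle costs only the constant factor
      exp (pi / 24).\<close>
    moreover have "exp (a * y + b * y / t\<^sup>2) = E * exp b"
      using y0 by (simp add: t2 ay E_def exp_add)
    ultimately have "exp (a * y + b * y / t\<^sup>2) \<le> E * (6 / 5)" using E by simp
    then have "exp (a * y + b * y / t\<^sup>2) * (4 * y + 2 * t) \<le> E * (6 / 5) * (4 * y + 2 * t)"
      using y0 t2 by (intro mult_right_mono) auto
    with segment_integral_bessel[OF a0 b0 y0 t2(2)]
    show ?thesis unfolding ab ba M_def by linarith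
  qed
  define D where "D = complex_of_real (sqrt 2 * q n) - 2 * pi * (pi / (12 * v)) * bessel_I1 v"
  have "D = (J (- t) t - integral {- t..t} M) + (integral {- t..t} M - 2 * pi * (pi / (12 * v)) * bessel_I1 v)
    + (J (- 1 / 2) (- 1 / 3 - y) + J (- 1 / 3 + y) (- t) + J t (1 / 3 - y) + J (1 / 3 + y) (1 / 2))
    + (J (- 1 / 3 - y) (- 1 / 3 + y) + J (1 / 3 - y) (1 / 3 + y))"
    unfolding D_def using total split by (simp add: algebra_simps)
  moreover have "norm (p + q + r + s) \<le> norm p + norm q + norm r + norm s" for p q r s :: complex
    by (intro order_trans[OF norm_triangle_ineq] add_mono order_refl)
  ultimately have "norm D \<le> norm (J (- t) t - integral {- t..t} M)
    + norm (integral {- t..t} M - 2 * pi * (pi / (12 * v)) * bessel_I1 v)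
    + norm (J (- 1 / 2) (- 1 / 3 - y) + J (- 1 / 3 + y) (- t) + J t (1 / 3 - y) + J (1 / 3 + y) (1 / 2))
    + norm (J (- 1 / 3 - y) (- 1 / 3 + y) + J (1 / 3 - y) (1 / 3 + y))"
    by (simp only:)
  also have "\<dots> \<le> 2 * E * (2 * t) + E * (6 / 5) * (4 * y + 2 * t) + 13 / 10 * exp (3 * v / 32) * E + 13 / 10 * E * E * (4 * y)"
    by (intro add_mono major bess far_sum near_sum)
  also have "2 * E * (2 * t) + E * (6 / 5) * (4 * y + 2 * t) = E * (4 * t + (6 / 5) * (4 * y + 2 * t))"
    by (simp add: algebra_simps)
  also have "\<dots> \<le> E * (6 / 10)"
  proof (rule mult_left_mono)
    show "4 * t + (6 / 5) * (4 * y + 2 * t) \<le> 6 / 10" using t1 y1 by argo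
  qed (use E in simp)
  finally have "norm D \<le> E * (6 / 10 + 13 / 10 * exp (3 * v / 32) + 13 / 10 * (4 * y) * E)"
    by (simp add: algebra_simps)
  moreover have "D = complex_of_real (sqrt 2 * q n - pi\<^sup>2 / (6 * v) * bessel_I1 v)"
    by (simp add: D_def power2_eq_square)
  moreover have "13 / 10 * (4 * y) = 13 * pi / (90 * v)" by (simp add: y_def)
  ultimately show ?thesis
    unfolding v_def [symmetric] E_def [symmetric] by (metis norm_of_real real_norm_def)
qed

theorem theorem1p2:
  fixes n :: nat
  assumes "0 < n"
  shows "(\<nu> n \<ge> 21 \<longleftrightarrow> n \<ge> 135) \<and>
    (\<nu> n \<ge> 21 \<longrightarrow>
      (\<exists>R::real.
        real (q n) = sqrt 2 * pi\<^sup>2 / (12 * \<nu> n) * bessel_I1 (\<nu> n) + R \<and>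
        \<bar>R\<bar> \<le> sqrt 3 * pi powr (3/2) / (6 * \<nu> n powr (1/2)) * exp (\<nu> n / 3)))"
proof (intro conjI impI nu_ge_21_iff)
  assume v21: "\<nu> n \<ge> 21"
  define v where "v = \<nu> n"
  define E where "E = exp (v / 6)"
  define R where "R = real (q n) - sqrt 2 * pi\<^sup>2 / (12 * v) * bessel_I1 v"
  have v: "v \<ge> 21" using v21 by (simp add: v_def)
  have E: "E > 0" "E * E = exp (v / 3)" by (simp_all add: E_def flip: exp_add)
  have sv: "sqrt v > 0" "sqrt v * sqrt v = v" using v by auto
  have "sqrt v \<le> sqrt (exp (7 * v / 48))" using le_exp_growth[OF v] by simp
  also have "\<dots> = exp (7 * v / 96)"
  proof -
    have "exp (7 * v / 48) = (exp (7 * v / 96))\<^sup>2" by (simp flip: exp_double)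
    then show ?thesis by simp
  qed
  finally have "exp (- (7 * v / 96)) \<le> 1 / sqrt v"
    using sv by (simp add: exp_minus divide_simps)
  then have e: "exp (- (7 * v / 96)) * E \<le> E / sqrt v"
    using E mult_right_mono[of "exp (- (7 * v / 96))" "1 / sqrt v" E] by simp
  have e1: "exp (3 * v / 32) = exp (- (7 * v / 96)) * E" by (simp add: E_def flip: exp_add)
  have e2: "1 \<le> exp (3 * v / 32)" using v by simp
  have e3: "13 * pi / (90 * v) * E \<le> 13 / 90 * (E / sqrt v)"
  proof -
    have "4 \<le> sqrt v" using v by (intro real_le_rsqrt) auto
    then have "pi / sqrt v \<le> 1" using pi_less_4 sv(1) by (subst divide_le_eq_1_pos) auto
    then have "13 / 90 * (E / sqrt v) * (pi / sqrt v) \<le> 13 / 90 * (E / sqrt v) * 1"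
      using E sv by (intro mult_left_mono) auto
    moreover have "13 / 90 * (E / sqrt v) * (pi / sqrt v) = 13 * pi / (90 * (sqrt v * sqrt v)) * E"
    proof -
      have "13 / 90 * (E / w) * (p / w) = 13 * p / (90 * (w * w)) * E" for w p :: real
        by (simp add: mult_ac)
      then show ?thesis .
    qed
    ultimately show ?thesis unfolding sv(2) by simp
  qed
  have "sqrt 2 * \<bar>R\<bar> = \<bar>sqrt 2 * q n - pi\<^sup>2 / (6 * v) * bessel_I1 v\<bar>"
  proof -
    have "sqrt 2 * R = sqrt 2 * q n - (sqrt 2 * sqrt 2) * pi\<^sup>2 / (12 * v) * bessel_I1 v"
      unfolding R_def by (simp only: right_diff_distrib mult.assoc times_divide_eq_right times_divide_eq_left)
    then have "sqrt 2 * R = sqrt 2 * q n - pi\<^sup>2 / (6 * v) * bessel_I1 v" by simp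
    then show ?thesis by (metis abs_mult abs_of_nonneg real_sqrt_ge_zero zero_le_numeral)
  qed
  also have "\<dots> \<le> E * (6 / 10 + 13 / 10 * exp (3 * v / 32) + 13 * pi / (90 * v) * E)"
    unfolding v_def E_def by (rule q_circle_method_bound[OF v21])
  \<comment> \<open>All three terms are measured in E / sqrt v, the constant being absorbed through
    1 <= exp (3 v / 32): 0.6 + 1.3 + 13 / 90 < 2.1.\<close>
  also have "\<dots> \<le> E * (21 / 10 * (E / sqrt v))"
  proof (rule mult_left_mono)
    have "exp (3 * v / 32) \<le> E / sqrt v" using e unfolding e1 .
    with e2 e3 show "6 / 10 + 13 / 10 * exp (3 * v / 32) + 13 * pi / (90 * v) * E \<le> 21 / 10 * (E / sqrt v)"
      by linarith
  qed (use E in simp)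
  also have "\<dots> = 21 / 10 * exp (v / 3) / sqrt v" by (simp flip: E(2))
  finally have R: "sqrt 2 * \<bar>R\<bar> \<le> 21 / 10 * exp (v / 3) / sqrt v" .
  \<comment> \<open>The true value is about 2.27; pi >= 3 and sqrt (6 pi) >= 4.2 give 3 * 4.2 / 6 =
    2.1 exactly.\<close>
  have const: "sqrt 2 * (sqrt 3 * pi powr (3 / 2) / 6) \<ge> 21 / 10"
  proof -
    have "pi powr (3 / 2) = pi * sqrt pi"
      using powr_add[of pi 1 "1 / 2"] by (simp add: powr_half_sqrt)
    moreover have "sqrt 2 * sqrt 3 * sqrt pi \<ge> 42 / 10"
    proof -
      have "42 / 10 \<le> sqrt (2 * 3 * pi)" using pi_bounds by (intro real_le_rsqrt) (auto simp: power2_eq_square)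
      then show ?thesis by (simp only: real_sqrt_mult)
    qed
    then have "3 * (42 / 10) \<le> pi * (sqrt 2 * sqrt 3 * sqrt pi)"
      using pi_bounds by (intro mult_mono) auto
    ultimately show ?thesis by (simp add: mult_ac)
  qed
  have "sqrt 2 * \<bar>R\<bar> \<le> sqrt 2 * (sqrt 3 * pi powr (3 / 2) / 6) * (exp (v / 3) / sqrt v)"
    using R mult_right_mono[OF const, of "exp (v / 3) / sqrt v"] sv by simp
  also have "\<dots> = sqrt 2 * (sqrt 3 * pi powr (3 / 2) / (6 * v powr (1 / 2)) * exp (v / 3))"
    using v by (simp add: powr_half_sqrt)
  finally have "\<bar>R\<bar> \<le> sqrt 3 * pi powr (3 / 2) / (6 * v powr (1 / 2)) * exp (v / 3)"
    by (rule mult_left_le_imp_le) simp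
  then show "\<exists>R. real (q n) = sqrt 2 * pi\<^sup>2 / (12 * \<nu> n) * bessel_I1 (\<nu> n) + R \<and>
        \<bar>R\<bar> \<le> sqrt 3 * pi powr (3/2) / (6 * \<nu> n powr (1/2)) * exp (\<nu> n / 3)"
    by (intro exI[of _ R]) (simp add: R_def v_def)
qed

end
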